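(* For a finite $2$-group $G$ let $\Theta_G(2)$ denote the number of elements $x\in V(\mathbb{F}_2G)$ with $x^2=1$ (the identity element being counted). Then $$\Theta_{D_{2^{n+1}}}(2)=2^{2^n+n-1}+2^{2^n}\quad\text{for all } n\ge 2,$$ $$\Theta_{SD_{2^{n+1}}}(2)=2^{2^n+n-1}\quad\text{for all } n\ge 3,$$ $$\Theta_{Q_{2^{n+1}}}(2)=2^{2^n+n-1}-2^{2^n}\quad\text{for all } n\ge 2.$$
   Context: $\mathbb{F}_2$ is the field of two elements and $\mathbb{F}_2G$ is the group algebra of $G$. For $x=\sum_{g\in G}\alpha_g g\in\mathbb{F}_2G$ put $\chi(x)=\sum_{g\in G}\alpha_g\in\mathbb{F}_2$. For a finite $2$-group $G$, $V(\mathbb{F}_2G)=\{x\in\mathbb{F}_2G : \chi(x)=1\}$ is the group (under multiplication) of normalized units; it has order $2^{|G|-1}$. The $2$-groups of maximal class are the following groups of order $2^{n+1}$, where $(a,b)=a^{-1}b^{-1}ab$: the generalized quaternion group $Q_{2^{n+1}}=\langle a,b_1 \mid a^{2^n}=1,\ b_1^2=a^{2^{n-1}},\ (a,b_1)=a^{-2}\rangle$, $n\ge2$; the dihedral group $D_{2^{n+1}}=\langle a,b_2 \mid a^{2^n}=1,\ b_2^2=1,\ (a,b_2)=a^{-2}\rangle$, $n\ge2$; the semidihedral group $SD_{2^{n+1}}=\langle a,b_3 \mid a^{2^n}=1,\ b_3^2=1,\ (a,b_3)=a^{-2+2^{n-1}}\rangle$, $n\ge3$. *)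

theory Defs
  imports "HOL-Library.Z2" "HOL-Algebra.Ring"
begin

section \<open>Groups given by generators and relations\<close>

text \<open>A letter \<open>(x, True)\<close> stands for the generator \<open>x\<close> and \<open>(x, False)\<close> for its inverse.\<close>

type_synonym 'x word = "('x \<times> bool) list"

definition gen :: "'x \<Rightarrow> 'x word" where
  "gen x = [(x, True)]"

definition word_inv :: "'x word \<Rightarrow> 'x word" where
  "word_inv w = rev (map (\<lambda>(x, e). (x, \<not> e)) w)"

definition word_pow :: "'x word \<Rightarrow> int \<Rightarrow> 'x word" where
  "word_pow w k =
     (if 0 \<le> k then concat (replicate (nat k) w)
      else concat (replicate (nat (- k)) (word_inv w)))"

definition word_comm :: "'x word \<Rightarrow> 'x word \<Rightarrow> 'x word" where
  "word_comm u v = word_inv u @ word_inv v @ u @ v"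

text \<open>The least congruence on words that contains the free cancellations and all relations
  \<open>u = v\<close> with \<open>(u, v) \<in> R\<close>.\<close>

inductive_set word_cong :: "('x word \<times> 'x word) set \<Rightarrow> ('x word \<times> 'x word) set"
  for R :: "('x word \<times> 'x word) set" where
  rel: "(u, v) \<in> R \<Longrightarrow> (u, v) \<in> word_cong R"
| cancel: "([(x, e), (x, \<not> e)], []) \<in> word_cong R"
| refl: "(u, u) \<in> word_cong R"
| sym: "(u, v) \<in> word_cong R \<Longrightarrow> (v, u) \<in> word_cong R"
| trans: "(u, v) \<in> word_cong R \<Longrightarrow> (v, w) \<in> word_cong R \<Longrightarrow> (u, w) \<in> word_cong R"
| append: "(u, u') \<in> word_cong R \<Longrightarrow> (v, v') \<in> word_cong R \<Longrightarrow> (u @ v, u' @ v') \<in> word_cong R"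

text \<open>The group presented by the relations \<open>R\<close>, the generators being all elements of \<open>'x\<close>.\<close>

definition presented_group :: "('x word \<times> 'x word) set \<Rightarrow> 'x word set monoid" where
  "presented_group R =
     \<lparr>carrier = UNIV // word_cong R,
      monoid.mult = (\<lambda>A B. \<Union>u\<in>A. \<Union>v\<in>B. word_cong R `` {u @ v}),
      one = word_cong R `` {[]}\<rparr>"

lemma equiv_word_cong: "equiv UNIV (word_cong R)"
proof (rule equivI)
  show "word_cong R \<subseteq> UNIV \<times> UNIV" by simp
  show "refl_on UNIV (word_cong R)"
    by (simp add: refl_on_def word_cong.refl)
  show "sym (word_cong R)"
    by (rule symI) (rule word_cong.sym)
  show "trans (word_cong R)"
    by (rule transI) (rule word_cong.trans)
qed

lemma presented_group_mult_class:
  "word_cong R `` {u} \<otimes>\<^bsub>presented_group R\<^esub> word_cong R `` {v} = word_cong R `` {u @ v}"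
proof -
  have "word_cong R `` {u' @ v'} = word_cong R `` {u @ v}"
    if "(u, u') \<in> word_cong R" "(v, v') \<in> word_cong R" for u' v'
    using equiv_class_eq[OF equiv_word_cong word_cong.append[OF that]] by simp
  moreover have "u \<in> word_cong R `` {u}" "v \<in> word_cong R `` {v}"
    by (auto intro: word_cong.refl)
  ultimately show ?thesis
    unfolding presented_group_def monoid.simps by blast
qed

lemma word_inv_left: "(word_inv w @ w, []) \<in> word_cong R"
proof (induction w)
  case Nil
  show ?case by (simp add: word_inv_def word_cong.refl)
next
  case (Cons l w)
  obtain x e where l: "l = (x, e)" by (cases l)
  have "([(x, \<not> e), (x, e)], []) \<in> word_cong R"
    using word_cong.cancel[of x "\<not> e" R] by simp
  then have "(word_inv w @ ([(x, \<not> e), (x, e)] @ w), word_inv w @ ([] @ w)) \<in> word_cong R"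
    by (intro word_cong.append word_cong.refl)
  then have "(word_inv (l # w) @ (l # w), word_inv w @ w) \<in> word_cong R"
    by (simp add: word_inv_def l)
  then show ?case using Cons by (rule word_cong.trans)
qed

lemma group_presented_group: "group (presented_group R)"
proof (rule groupI)
  have car: "\<exists>u. A = word_cong R `` {u}" if "A \<in> carrier (presented_group R)" for A
    using that by (auto simp: presented_group_def quotient_def)
  have in_car: "word_cong R `` {u} \<in> carrier (presented_group R)" for u
    by (simp add: presented_group_def quotientI)
  have one: "\<one>\<^bsub>presented_group R\<^esub> = word_cong R `` {[]}"
    by (simp add: presented_group_def)
  show "\<one>\<^bsub>presented_group R\<^esub> \<in> carrier (presented_group R)"
    by (simp add: one in_car)
  fix A assume A: "A \<in> carrier (presented_group R)"
  then obtain u where u: "A = word_cong R `` {u}" using car by blast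
  show "\<one>\<^bsub>presented_group R\<^esub> \<otimes>\<^bsub>presented_group R\<^esub> A = A"
    by (simp add: one u presented_group_mult_class)
  have "word_cong R `` {word_inv u} \<otimes>\<^bsub>presented_group R\<^esub> A = \<one>\<^bsub>presented_group R\<^esub>"
    using equiv_class_eq[OF equiv_word_cong word_inv_left]
    by (simp add: one u presented_group_mult_class)
  then show "\<exists>B\<in>carrier (presented_group R). B \<otimes>\<^bsub>presented_group R\<^esub> A = \<one>\<^bsub>presented_group R\<^esub>"
    using in_car by blast
  fix B assume B: "B \<in> carrier (presented_group R)"
  then obtain v where v: "B = word_cong R `` {v}" using car by blast
  show "A \<otimes>\<^bsub>presented_group R\<^esub> B \<in> carrier (presented_group R)"
    by (simp add: u v presented_group_mult_class in_car)
  fix C assume "C \<in> carrier (presented_group R)"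
  then obtain w where w: "C = word_cong R `` {w}" using car by blast
  show "A \<otimes>\<^bsub>presented_group R\<^esub> B \<otimes>\<^bsub>presented_group R\<^esub> C
      = A \<otimes>\<^bsub>presented_group R\<^esub> (B \<otimes>\<^bsub>presented_group R\<^esub> C)"
    by (simp add: u v w presented_group_mult_class)
qed

section \<open>The 2-groups of maximal class\<close>

datatype generator = GenA | GenB

abbreviation wa :: "generator word" where "wa \<equiv> gen GenA"
abbreviation wb :: "generator word" where "wb \<equiv> gen GenB"

text \<open>The parameter \<open>n\<close> gives the group of order \<open>2 ^ (n + 1)\<close>.\<close>

definition quaternion_group :: "nat \<Rightarrow> generator word set monoid" where
  "quaternion_group n = presented_group
     {(word_pow wa (2 ^ n), []),
      (word_pow wb 2, word_pow wa (2 ^ (n - 1))),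
      (word_comm wa wb, word_pow wa (- 2))}"

definition dihedral_group :: "nat \<Rightarrow> generator word set monoid" where
  "dihedral_group n = presented_group
     {(word_pow wa (2 ^ n), []),
      (word_pow wb 2, []),
      (word_comm wa wb, word_pow wa (- 2))}"

definition semidihedral_group :: "nat \<Rightarrow> generator word set monoid" where
  "semidihedral_group n = presented_group
     {(word_pow wa (2 ^ n), []),
      (word_pow wb 2, []),
      (word_comm wa wb, word_pow wa (- 2 + 2 ^ (n - 1)))}"

section \<open>Group algebras and normalized units\<close>

text \<open>The group algebra of a finite group \<open>G\<close> over a commutative ring, the element
  \<open>\<Sum>g\<in>G. \<alpha>\<^sub>g g\<close> being encoded as the coefficient function \<open>g \<mapsto> \<alpha>\<^sub>g\<close>,
  which is set to \<open>0\<close> outside the carrier of \<open>G\<close>.\<close>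

definition group_algebra :: "('a, 'm) monoid_scheme \<Rightarrow> ('a \<Rightarrow> 'k::comm_ring_1) ring" where
  "group_algebra G =
     \<lparr>carrier = {x. \<forall>g. g \<notin> carrier G \<longrightarrow> x g = 0},
      monoid.mult = (\<lambda>x y g. \<Sum>(h, k) \<in> {(h, k) \<in> carrier G \<times> carrier G. h \<otimes>\<^bsub>G\<^esub> k = g}. x h * y k),
      one = (\<lambda>g. if g = \<one>\<^bsub>G\<^esub> then 1 else 0),
      ring.zero = (\<lambda>g. 0),
      add = (\<lambda>x y g. x g + y g)\<rparr>"

definition augmentation :: "('a, 'm) monoid_scheme \<Rightarrow> ('a \<Rightarrow> 'k::comm_ring_1) \<Rightarrow> 'k" where
  "augmentation G x = (\<Sum>g\<in>carrier G. x g)"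

text \<open>\<open>bit\<close> is the field with two elements.\<close>

definition normalized_units :: "('a, 'm) monoid_scheme \<Rightarrow> ('a \<Rightarrow> bit) monoid" where
  "normalized_units G =
     \<lparr>carrier = {x \<in> carrier (group_algebra G). augmentation G x = 1},
      monoid.mult = monoid.mult (group_algebra G),
      one = one (group_algebra G)\<rparr>"

definition Theta2 :: "('a, 'm) monoid_scheme \<Rightarrow> nat" where
  "Theta2 G = card {x \<in> carrier (normalized_units G).
     x [^]\<^bsub>normalized_units G\<^esub> (2::nat) = \<one>\<^bsub>normalized_units G\<^esub>}"

end

theory Submission
  imports Defs "HOL-Computational_Algebra.Formal_Power_Series"
begin

text \<open>
Put \<open>N = 2^n\<close>. Over \<open>F\<^sub>2\<close> we have \<open>a^N - 1 = (a - 1)^N\<close>, so the group algebra of the cyclic subgroup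
generated by \<open>a\<close> is \<open>F\<^sub>2[X]/(X^N)\<close> with \<open>a = 1 + X\<close>, a ring in which every element is a unit times
a power of \<open>X\<close>. In all three groups \<open>b^2 = a^c\<close>, and conjugation by \<open>b\<close> induces an
involution \<open>sig\<close> of this ring with \<open>sig a = a^e\<close>. An element \<open>1 + y + v b\<close> squares to \<open>1\<close> if and only if
\<open>y^2 = a^c v (sig v)\<close> and \<open>v (y + sig y) = 0\<close>; such elements automatically have augmentation \<open>1\<close>.

Let \<open>k\<close> be the order of vanishing of \<open>y\<close>. If \<open>k \<ge> N/2\<close>, the equations hold precisely if \<open>v\<close> vanishes
to order at least \<open>N/2\<close> as well, which gives \<open>2^N\<close> solutions. If \<open>k < N/2\<close>, then \<open>v = q y\<close> with a
unit \<open>q\<close>, and the equations decouple (\<open>sol_iff\<close>) into \<open>sig y \<equiv> y\<close> modulo \<open>X^(N - k)\<close> and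
\<open>norm q \<equiv> a^c\<close> modulo \<open>X^(N - 2 k)\<close>, where \<open>norm q = q (sig q)\<close>. The key fact about \<open>sig\<close> is
\<open>sig X^m = X^m + m X^(m + 1) + \<dots>\<close> (\<open>sig_low\<close>). It excludes odd \<open>k\<close> and yields \<open>2^(N/2)\<close> choices of
\<open>y\<close> for every even \<open>k\<close> (\<open>card_first_components\<close>). It also shows which orders \<open>q - 1\<close> can have for
\<open>q\<close> in the kernel of the norm (\<open>kernel_levels_iff\<close>) and that the norm equation is solvable for \<open>k > 0\<close>
(\<open>norm_approx\<close>); so every \<open>y\<close> with \<open>0 < k < N/2\<close> belongs to \<open>2^(N/2 + 1)\<close> solutions.

Only \<open>k = 0\<close>, where the norm equation has to hold modulo the full power \<open>X^N\<close>, sees the difference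
between the families. The coefficient of \<open>a^(N/2)\<close> vanishes on all norms if
\<open>e = N - 1\<close> (\<open>lam_norm_inverting\<close>). Hence there is no solution for the quaternion group, where
\<open>a^c = a^(N/2)\<close>, while the dihedral group has \<open>2^(N/2 + 1)\<close> solutions for each \<open>y\<close> as before. In
the semidihedral case that coefficient of \<open>norm q\<close> is the coefficient of \<open>X\<close> in \<open>q\<close>
(\<open>lam_norm_semi\<close>), which halves the kernel. Adding up (\<open>card_solutions\<close>) gives
\<open>2^N + (N/4 - 1) 2^(N + 1)\<close> plus \<open>2^(N + 1)\<close>, \<open>2^N\<close> or \<open>0\<close>.

The presentations enter through the normal form \<open>a^i b^\<beta>\<close> with \<open>i < N\<close> (\<open>el_bij\<close>): the relations reduce
every word to it, and an explicit action of words on the indices separates the normal forms.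
\<close>

section \<open>Power series over the field with two elements\<close>

unbundle fps_syntax

text \<open>The default simplification rules turn sums and products of bits into Boolean operations, which
hides the ring structure.\<close>

declare add_bit_eq_xor [simp del] mult_bit_eq_and [simp del]

lemma of_bool_bit [simp]: "of_bool (b = 1) = (b::bit)"
  by (cases b) auto

lemma UNIV_bit: "(UNIV :: bit set) = {0, 1}"
  using bit_not_one_iff by blast

lemma fps_bit_2 [simp]: "(2::bit fps) = 0"
  by (simp add: numeral_fps_const)

lemma fps_bit_add_self: "(f::bit fps) + f = 0"
  by (simp flip: mult_2)

lemma fps_bit_add_add [simp]: "(f::bit fps) + (f + g) = g"
  by (simp add: fps_bit_add_self flip: add.assoc)

lemma fps_bit_square_add: "((f::bit fps) + g)^2 = f^2 + g^2"
proof -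
  have "(f + g)^2 = f^2 + g^2 + (f * g + f * g)"
    by (simp add: power2_eq_square algebra_simps)
  then show ?thesis by simp
qed

lemma fps_bit_pow2_add: "((f::bit fps) + g)^(2^k) = f^(2^k) + g^(2^k)"
proof (induction k)
  case (Suc k)
  show ?case
    by (simp add: power_mult mult.commute[of 2] Suc fps_bit_square_add)
qed simp

text \<open>Congruence modulo \<open>X^m\<close>. The group algebra of a cyclic group of order \<open>N = 2^n\<close> is
\<open>F\<^sub>2[X]/(X^N)\<close>; its elements are represented by power series rather than by classes, because
power series with constant term \<open>1\<close> are invertible on the nose.\<close>

definition eqX :: "nat \<Rightarrow> bit fps \<Rightarrow> bit fps \<Rightarrow> bool" where
  "eqX m f g \<longleftrightarrow> (\<forall>i<m. f $ i = g $ i)"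

lemma eqX_refl [simp]: "eqX m f f" by (simp add: eqX_def)
lemma eqX_sym: "eqX m f g \<Longrightarrow> eqX m g f" by (simp add: eqX_def)
lemma eqX_trans [trans]: "eqX m f g \<Longrightarrow> eqX m g h \<Longrightarrow> eqX m f h" by (simp add: eqX_def)
lemma eqX_mono: "eqX m f g \<Longrightarrow> k \<le> m \<Longrightarrow> eqX k f g" by (simp add: eqX_def)
lemma eqX_add: "eqX m f f' \<Longrightarrow> eqX m g g' \<Longrightarrow> eqX m (f + g) (f' + g')" by (simp add: eqX_def)
lemma eqX_mult: "eqX m f f' \<Longrightarrow> eqX m g g' \<Longrightarrow> eqX m (f * g) (f' * g')"
  by (simp add: eqX_def fps_mult_nth)
lemma eqX_power: "eqX m f f' \<Longrightarrow> eqX m (f ^ k) (f' ^ k)"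
  by (induction k) (auto intro: eqX_mult)
lemma eqX_sum: "(\<And>i. i \<in> I \<Longrightarrow> eqX m (f i) (g i)) \<Longrightarrow> eqX m (sum f I) (sum g I)"
  by (simp add: eqX_def fps_sum_nth)
lemma eqX_Suc: "eqX (Suc m) f g \<longleftrightarrow> eqX m f g \<and> f $ m = g $ m"
  by (auto simp: eqX_def less_Suc_eq)
lemma eqX_add_iff: "eqX m (f + g) 0 \<longleftrightarrow> eqX m f g"
proof -
  have "(x + y = 0) = (x = y)" for x y :: bit by (cases x; cases y) auto
  then show ?thesis by (simp add: eqX_def)
qed
lemma eqX_0_iff: "eqX m f 0 \<longleftrightarrow> (\<exists>g. f = fps_X^m * g)"
proof
  assume "eqX m f 0"
  then have "f = fps_X^m * fps_shift m f"
    by (auto simp: fps_eq_iff fps_X_power_mult_nth eqX_def)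
  then show "\<exists>g. f = fps_X^m * g" ..
qed (auto simp: eqX_def fps_X_power_mult_nth)

lemma eqX_mult_0: "eqX k f 0 \<Longrightarrow> eqX m g 0 \<Longrightarrow> eqX (k + m) (f * g) 0"
  unfolding eqX_0_iff by (force simp: power_add algebra_simps)

lemma eqX_mult_X_iff: "eqX (k + m) (fps_X^k * f) (fps_X^k * g) \<longleftrightarrow> eqX m f g"
proof
  assume *: "eqX (k + m) (fps_X^k * f) (fps_X^k * g)"
  show "eqX m f g" unfolding eqX_def
  proof (intro allI impI)
    fix i assume "i < m"
    then show "f $ i = g $ i"
      using *[unfolded eqX_def, rule_format, of "k + i"] by (simp add: fps_X_power_mult_nth)
  qed
qed (auto simp: eqX_def fps_X_power_mult_nth)

lemma unit_inverse: "(f::bit fps) $ 0 = 1 \<Longrightarrow> f * inverse f = 1"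
  using inverse_mult_eq_1[of f] by (simp add: mult.commute)

lemma eqX_unit_cancel:
  assumes "u $ 0 = 1"
  shows "eqX m (u * f) (u * g) \<longleftrightarrow> eqX m f g"
proof
  assume "eqX m (u * f) (u * g)"
  then have "eqX m (inverse u * (u * f)) (inverse u * (u * g))"
    by (rule eqX_mult[OF eqX_refl])
  moreover have "inverse u * (u * h) = h" for h
    using unit_inverse[OF assms] by (metis mult.assoc mult.commute mult_1)
  ultimately show "eqX m f g" by simp
qed (auto intro: eqX_mult)

definition val_is :: "nat \<Rightarrow> bit fps \<Rightarrow> bool" where
  "val_is k f \<longleftrightarrow> eqX k f 0 \<and> f $ k = 1"

lemma val_is_iff: "val_is k f \<longleftrightarrow> (\<exists>u. u $ 0 = 1 \<and> f = fps_X^k * u)"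
  by (auto simp: val_is_def eqX_0_iff fps_X_power_mult_nth)

lemma val_is_mult: "val_is k f \<Longrightarrow> val_is m g \<Longrightarrow> val_is (k + m) (f * g)"
  unfolding val_is_iff
proof (elim exE conjE)
  fix u v assume "u $ 0 = 1" "f = fps_X^k * u" "v $ 0 = 1" "g = fps_X^m * v"
  then show "\<exists>w. w $ 0 = 1 \<and> f * g = fps_X^(k + m) * w"
    by (intro exI[of _ "u * v"]) (simp add: power_add)
qed

lemma ex_val:
  "eqX m f 0 \<or> (\<exists>k<m. val_is k f)"
proof (induction m)
  case 0
  then show ?case by (simp add: eqX_def)
next
  case (Suc m)
  then show ?case
    by (cases "f $ m") (auto simp: val_is_def eqX_Suc intro: less_SucI)
qed

lemma val_is_unique: "val_is k f \<Longrightarrow> val_is l f \<Longrightarrow> k = l"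
  unfolding val_is_def eqX_def
  by (metis bit.distinct(1) fps_zero_nth linorder_neqE_nat)

lemma not_eqX_val: "val_is k f \<Longrightarrow> eqX m f 0 \<longleftrightarrow> m \<le> k"
  unfolding val_is_def eqX_def
  by (metis bit.distinct(1) fps_zero_nth linorder_not_le order_less_le_trans)

definition trunc_set :: "nat \<Rightarrow> bit fps set" where
  "trunc_set N = {f. \<forall>i\<ge>N. f $ i = 0}"

lemma cutoff_in [simp]: "fps_cutoff N f \<in> trunc_set N"
  by (simp add: trunc_set_def)

lemma cutoff_eqX [simp]: "eqX N (fps_cutoff N f) f"
  by (simp add: eqX_def)

lemma cutoff_eqX_le: "m \<le> N \<Longrightarrow> eqX m (fps_cutoff N f) f"
  by (simp add: eqX_def)

lemma trunc_eqX_eq: "f \<in> trunc_set N \<Longrightarrow> g \<in> trunc_set N \<Longrightarrow> eqX N f g \<Longrightarrow> f = g"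
  by (auto simp: trunc_set_def eqX_def fps_eq_iff) (metis not_less)

text \<open>Every cardinality below is computed with this lemma. The coefficients of an element of \<open>W\<close> are
chosen one after the other; at an index in \<open>V\<close> both values of the next coefficient occur, at
any other index the preceding coefficients determine it. For an additive subgroup \<open>V\<close> is the
set of orders of vanishing of its nonzero elements, but the lemma applies equally to cosets
of multiplicative groups.\<close>

lemma card_branching:
  assumes W: "W \<noteq> {}" "W \<subseteq> trunc_set N" and V: "V \<subseteq> {..<N}"
    and ext: "\<And>m w. m \<in> V \<Longrightarrow> w \<in> W \<Longrightarrow> \<exists>w'\<in>W. eqX m w w' \<and> w $ m \<noteq> w' $ m"
    and uniq: "\<And>m w w'. m < N \<Longrightarrow> m \<notin> V \<Longrightarrow> w \<in> W \<Longrightarrow> w' \<in> W \<Longrightarrow> eqX m w w' \<Longrightarrow> w $ m = w' $ m"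
  shows "card W = 2 ^ card V"
proof -
  let ?P = "\<lambda>m. fps_cutoff m ` W"
  have eqc: "fps_cutoff m w = fps_cutoff m w' \<longleftrightarrow> eqX m w w'" for m w w'
    by (simp add: fps_cutoff_eq_fps_cutoff_iff eqX_def)
  have step: "finite (?P m) \<and> card (?P m) = 2 ^ card (V \<inter> {..<m})" if "m \<le> N" for m
    using that
  proof (induction m)
    case 0
    have "?P 0 = {0}" using W(1) by auto
    then show ?case by simp
  next
    case (Suc m)
    then have IH: "finite (?P m)" "card (?P m) = 2 ^ card (V \<inter> {..<m})" by auto
    show ?case
    proof (cases "m \<in> V")
      case True
      have eq: "?P (Suc m) = (\<lambda>(p, b). p + fps_const b * fps_X^m) ` (?P m \<times> UNIV)" (is "_ = ?h ` _")
      proof (intro equalityI subsetI)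
        fix p assume "p \<in> ?P (Suc m)"
        then obtain w where w: "w \<in> W" "p = fps_cutoff (Suc m) w" by auto
        then have "p = ?h (fps_cutoff m w, w $ m)"
          by (auto simp: fps_eq_iff less_Suc_eq)
        then show "p \<in> ?h ` (?P m \<times> UNIV)" using w(1) by blast
      next
        fix p assume "p \<in> ?h ` (?P m \<times> UNIV)"
        then obtain w b where w: "w \<in> W" "p = ?h (fps_cutoff m w, b)" by auto
        show "p \<in> ?P (Suc m)"
        proof (cases "w $ m = b")
          case t: True
          have "p = fps_cutoff (Suc m) w" using w t by (auto simp: fps_eq_iff less_Suc_eq)
          then show ?thesis using w by blast
        next
          case f: False
          from ext[OF True w(1)] obtain w' where w': "w' \<in> W" "eqX m w w'" "w $ m \<noteq> w' $ m" by blast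
          then have "w' $ m = b" using f by (cases b; cases "w $ m"; cases "w' $ m") auto
          then have "p = fps_cutoff (Suc m) w'"
            using w(2) w'(2) by (auto simp: fps_eq_iff less_Suc_eq eqX_def)
          then show ?thesis using w' by blast
        qed
      qed
      have inj: "inj_on ?h (?P m \<times> UNIV)"
      proof (rule inj_onI)
        fix x y assume xy: "x \<in> ?P m \<times> (UNIV::bit set)" "y \<in> ?P m \<times> UNIV" "?h x = ?h y"
        obtain p b q d where [simp]: "x = (p, b)" "y = (q, d)" by (cases x; cases y) auto
        from xy have z: "p $ i = 0" "q $ i = 0" if "i \<ge> m" for i using that by auto
        have h: "(p + fps_const b * fps_X^m) $ i = (q + fps_const d * fps_X^m) $ i" for i
          using xy(3) by simp
        have "b = d" using h[of m] z[of m] by simp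
        moreover have "p = q"
        proof (rule fps_ext)
          fix i show "p $ i = q $ i"
            using h[of i] z[of i] by (cases "i = m") auto
        qed
        ultimately show "x = y" by simp
      qed
      have "V \<inter> {..<Suc m} = insert m (V \<inter> {..<m})" using True by (auto simp: less_Suc_eq)
      then show ?thesis
        unfolding eq 
        using IH by (simp add: card_image[OF inj[unfolded UNIV_bit]] card_cartesian_product UNIV_bit)
    next
      case False
      have inj: "inj_on (fps_cutoff m) (?P (Suc m))"
      proof (rule inj_onI, elim imageE)
        fix x y w w' assume a: "fps_cutoff m x = fps_cutoff m y"
          "x = fps_cutoff (Suc m) w" "y = fps_cutoff (Suc m) w'" "w \<in> W" "w' \<in> W"
        have "eqX m w w'"
          unfolding eqX_def
        proof (intro allI impI)
          fix i assume "i < m"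
          moreover have "fps_cutoff m x $ i = fps_cutoff m y $ i" using a(1) by simp
          ultimately show "w $ i = w' $ i" using a(2,3) by simp
        qed
        moreover from this have "w $ m = w' $ m"
          using uniq[of m w w'] a Suc.prems False by auto
        ultimately show "x = y" unfolding a(2,3) eqc by (simp add: eqX_Suc)
      qed
      have im: "fps_cutoff m ` ?P (Suc m) = ?P m"
        by (auto simp: image_image fps_eq_iff intro!: image_cong)
      have "finite (?P (Suc m))"
        using inj IH(1) im finite_imageD by metis
      moreover have "card (?P (Suc m)) = card (?P m)"
        using card_image[OF inj] im by simp
      moreover have "V \<inter> {..<Suc m} = V \<inter> {..<m}" using False by (auto simp: less_Suc_eq)
      ultimately show ?thesis using IH by simp
    qed
  qed
  have "?P N = W"
  proof -
    have "fps_cutoff N w = w" if "w \<in> W" for w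
      using that W(2) by (auto simp: trunc_set_def fps_eq_iff)
    then show ?thesis by simp
  qed
  moreover have "V \<inter> {..<N} = V" using V by auto
  ultimately show ?thesis using step[of N] by simp
qed

section \<open>The twisted norm on truncated power series\<close>

lemma of_nat_bit: "of_nat m = (of_bool (odd m) :: bit)"
  by (induction m) auto

text \<open>The parameters describe the group with \<open>a^N = 1\<close>, \<open>b a b\<inverse> = a^e\<close> and \<open>b^2 = a^c\<close>. With
\<open>e = N - 1\<close> it is dihedral for \<open>c = 0\<close> and quaternion for \<open>c = N/2\<close>; with
\<open>e = N/2 - 1\<close> and \<open>c = 0\<close> it is semidihedral.\<close>

locale maximal_class =
  fixes n e c N p :: nat
  assumes n2: "2 \<le> n" and N_eq: "N = 2 ^ n" and N_p: "N = 4 * p"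
    and e_cases: "e = N - 1 \<or> e = 2 * p - 1 \<and> 3 \<le> n"
    and c_cases: "c = 0 \<or> c = 2 * p \<and> e = N - 1"
begin

lemma p_pos: "0 < p"
proof -
  have "0 < N" by (simp add: N_eq)
  then show ?thesis by (simp add: N_p)
qed

text \<open>Writing \<open>N\<close> and \<open>e\<close> without subtraction makes \<open>e \<equiv> 3\<close> modulo \<open>4\<close> and \<open>e\<^sup>2 \<equiv> 1\<close>
modulo \<open>N\<close> evident. These two congruences are all that most of the argument uses about \<open>e\<close>.\<close>

lemma e_forms: "(\<exists>x. N = 4 * x + 4 \<and> e = 4 * x + 3) \<or> (\<exists>x. N = 8 * x + 8 \<and> e = 4 * x + 3)"
  using e_cases
proof
  assume "e = N - 1"
  moreover obtain x where "p = Suc x" using p_pos by (cases p) auto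
  ultimately have "N = 4 * x + 4 \<and> e = 4 * x + 3" by (simp add: N_p)
  then show ?thesis by blast
next
  assume a: "e = 2 * p - 1 \<and> 3 \<le> n"
  then have "(2::nat) ^ 3 dvd 2 ^ n" by (intro le_imp_power_dvd) simp
  then obtain q where q: "N = 8 * q" unfolding N_eq by auto
  moreover from this obtain x where "q = Suc x" using p_pos N_p by (cases q) auto
  ultimately have "N = 8 * x + 8 \<and> e = 4 * x + 3" using a N_p by simp
  then show ?thesis by blast
qed

lemma e_mod_4: "e mod 4 = 3"
  using e_forms by (elim disjE exE conjE) simp_all

lemma e_odd: "odd e"
  using e_mod_4 by presburger

lemma e_square: "\<exists>r. e * e = 1 + N * r"
  using e_forms
proof (elim disjE exE conjE)
  fix x assume "N = 4 * x + 4" "e = 4 * x + 3"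
  then have "e * e = 1 + N * (4 * x + 2)" by (simp add: algebra_simps)
  then show ?thesis ..
next
  fix x assume "N = 8 * x + 8" "e = 4 * x + 3"
  then have "e * e = 1 + N * (2 * x + 1)" by (simp add: algebra_simps)
  then show ?thesis ..
qed

lemma pow_N: "(1 + fps_X :: bit fps) ^ N = 1 + fps_X ^ N"
  unfolding N_eq fps_bit_pow2_add by simp

lemma pow_N_mult: "eqX N ((1 + fps_X) ^ (N * r)) 1"
proof -
  have "eqX N (1 + fps_X ^ N) 1" by (simp add: eqX_def)
  then have "eqX N ((1 + fps_X ^ N) ^ r) (1 ^ r)" by (rule eqX_power)
  then show ?thesis by (simp add: power_mult pow_N)
qed

text \<open>Conjugation by \<open>b\<close> maps \<open>a = 1 + X\<close> to \<open>a^e\<close>, hence \<open>X\<close> to \<open>a^e + 1\<close>.\<close>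

definition tau :: "bit fps" where "tau = (1 + fps_X) ^ e + 1"

definition sig :: "bit fps \<Rightarrow> bit fps" where "sig f = f oo tau"

lemma one_plus_X_e: "eqX 4 ((1 + fps_X) ^ e) (1 + fps_X + fps_X^2 + fps_X^3)"
proof -
  have e: "e = 4 * (e div 4) + 3" using e_mod_4 by presburger
  have 4: "(1 + fps_X :: bit fps) ^ 4 = 1 + fps_X ^ 4"
    using fps_bit_pow2_add[of 1 fps_X 2] by simp
  have 3: "(1 + fps_X :: bit fps) ^ 3 = 1 + fps_X + fps_X^2 + fps_X^3"
    by (simp add: power3_eq_cube power2_eq_square algebra_simps)
  have "eqX 4 (1 + fps_X ^ 4) 1" by (simp add: eqX_def)
  then have "eqX 4 ((1 + fps_X ^ 4) ^ (e div 4) * (1 + fps_X) ^ 3) (1 ^ (e div 4) * (1 + fps_X)^3)"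
    by (intro eqX_mult eqX_power eqX_refl)
  then show ?thesis
    by (subst e) (simp only: power_add power_mult 4 3 power_one mult_1)
qed

lemma tau_nth: "tau $ 0 = 0" "tau $ Suc 0 = 1" "tau $ 2 = 1"
  using one_plus_X_e by (auto simp: tau_def eqX_def)

lemma sig_add: "sig (f + g) = sig f + sig g"
  by (simp add: sig_def fps_compose_add_distrib)
lemma sig_mult: "sig (f * g) = sig f * sig g"
  by (simp add: sig_def fps_compose_mult_distrib tau_nth)
lemma sig_0 [simp]: "sig 0 = 0" and sig_1 [simp]: "sig 1 = 1"
  by (simp_all add: sig_def)
lemma sig_power: "sig (f ^ k) = sig f ^ k"
  by (induction k) (simp_all add: sig_mult)
lemma sig_X: "sig fps_X = tau"
  by (simp add: sig_def tau_nth)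
lemma sig_a: "sig (1 + fps_X) = (1 + fps_X) ^ e"
  by (simp add: sig_add sig_X) (simp add: tau_def add.commute)
lemma sig_nth_0 [simp]: "sig f $ 0 = f $ 0"
  by (simp add: sig_def)
lemma sig_nth_1 [simp]: "sig f $ Suc 0 = f $ Suc 0"
  by (simp add: sig_def fps_compose_nth tau_nth)

lemma sig_eqX: "eqX m f g \<Longrightarrow> eqX m (sig f) (sig g)"
  by (auto simp: eqX_def sig_def fps_compose_nth intro!: sum.cong)

lemma eqX_compose:
  assumes "\<And>k. eqX m (g ^ k) (h ^ k)"
  shows "eqX m (f oo g) (f oo h)"
  using assms by (auto simp: eqX_def fps_compose_nth intro!: sum.cong)

text \<open>Only modulo \<open>X^N\<close>, since this rests on \<open>a^(e * e) = a\<close>, that is on \<open>a^N = 1\<close>.\<close>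

lemma sig_sig: "eqX N (sig (sig f)) f"
proof -
  obtain r where r: "e * e = 1 + N * r" using e_square by blast
  have "tau oo tau = sig tau" by (simp add: sig_def)
  also have "\<dots> = (sig (1 + fps_X)) ^ e + 1"
    by (simp add: tau_def sig_add sig_power)
  also have "\<dots> = (1 + fps_X) * (1 + fps_X) ^ (N * r) + 1"
    by (simp add: sig_a power_mult[symmetric] r)
  finally have t: "tau oo tau = (1 + fps_X) * (1 + fps_X) ^ (N * r) + 1" .
  have "eqX N ((1 + fps_X) * (1 + fps_X) ^ (N * r) + 1) ((1 + fps_X) * 1 + 1)"
    by (intro eqX_add eqX_mult pow_N_mult eqX_refl)
  then have "eqX N (tau oo tau) fps_X" unfolding t by (simp add: add.commute)
  then have "eqX N ((tau oo tau) ^ k) (fps_X ^ k)" for k by (rule eqX_power)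
  then have "eqX N (f oo (tau oo tau)) (f oo fps_X)"
    by (rule eqX_compose)
  then show ?thesis by (simp add: sig_def fps_compose_assoc tau_nth)
qed

text \<open>\<open>theta\<close> is the unit \<open>1 + X + \<dots>\<close> with \<open>sig X = X * theta\<close>. Its coefficient of \<open>X\<close> is \<open>1\<close>
because \<open>e \<equiv> 3\<close> modulo \<open>4\<close>, and everything about orders of vanishing follows from it.\<close>

definition theta :: "bit fps" where "theta = fps_shift 1 tau"

lemma tau_eq: "tau = fps_X * theta"
  by (simp add: fps_eq_iff theta_def tau_nth)

lemma theta_pow: "(theta ^ k) $ 0 = 1" "(theta ^ k) $ Suc 0 = of_nat k"
proof -
  have t: "theta $ 0 = 1" "theta $ Suc 0 = 1"
    using tau_nth by (simp_all add: theta_def numeral_2_eq_2)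
  show "(theta ^ k) $ 0 = 1" "(theta ^ k) $ Suc 0 = of_nat k"
    by (induction k) (simp_all add: t fps_mult_nth)
qed

text \<open>From \<open>sig X^m = X^m * theta^m\<close> and \<open>theta^m = 1 + m X + \<dots>\<close>: adding the image under \<open>sig\<close>
raises the order of vanishing by exactly one if it is odd, and by at least two otherwise.\<close>

lemma sig_low:
  assumes "eqX m f 0"
  shows "eqX (Suc m) (f + sig f) 0" "(f + sig f) $ Suc m = of_nat m * f $ m"
proof -
  obtain g where g: "f = fps_X^m * g" using assms by (auto simp: eqX_0_iff)
  have "f + sig f = fps_X ^ m * (g + theta ^ m * sig g)"
    by (simp add: g sig_mult sig_power sig_X tau_eq power_mult_distrib algebra_simps)
  moreover have "(g + theta ^ m * sig g) $ 0 = 0"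
    by (simp add: fps_mult_nth theta_pow)
  moreover have "(g + theta ^ m * sig g) $ Suc 0 = of_nat m * g $ 0"
    by (simp add: fps_mult_nth theta_pow)
  ultimately show "eqX (Suc m) (f + sig f) 0" "(f + sig f) $ Suc m = of_nat m * f $ m"
    by (auto simp: eqX_def fps_X_power_mult_nth g less_Suc_eq)
qed

lemma sig_eqX_Suc: "eqX m f 0 \<Longrightarrow> eqX (Suc m) f (sig f)"
  using sig_low(1) eqX_add_iff by blast

lemma val_sig: "val_is m f \<Longrightarrow> val_is m (sig f)"
  using sig_eqX_Suc[of m f] by (auto simp: val_is_def eqX_Suc eqX_def)

lemma val_odd: "val_is m f \<Longrightarrow> odd m \<Longrightarrow> val_is (Suc m) (f + sig f)"
  using sig_low[of m f] by (simp add: val_is_def of_nat_bit)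

text \<open>Consequently an element fixed by \<open>sig\<close> modulo \<open>X^L\<close> vanishes to even order, the only exception
being the order \<open>L - 1\<close>, at which the obstruction is no longer visible.\<close>

lemma symmetric_val:
  assumes "eqX L f (sig f)" "val_is m f" "odd m"
  shows "L \<le> Suc m"
  using not_eqX_val[OF val_odd[OF assms(2,3)], of L] assms(1) by (simp add: eqX_add_iff)

definition norm :: "bit fps \<Rightarrow> bit fps" where "norm f = f * sig f"

lemma norm_mult: "norm (f * g) = norm f * norm g"
  by (simp add: norm_def sig_mult mult_ac)
lemma norm_power: "norm (f ^ k) = norm f ^ k"
  by (simp add: norm_def sig_power power_mult_distrib)
lemma norm_1 [simp]: "norm 1 = 1"
  by (simp add: norm_def)
lemma norm_0_nth: "norm f $ 0 = f $ 0"
  by (cases "f $ 0") (simp_all add: norm_def)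
lemma norm_eqX: "eqX m f g \<Longrightarrow> eqX m (norm f) (norm g)"
  by (simp add: norm_def eqX_mult sig_eqX)
lemma norm_symmetric: "eqX N (norm f) (sig (norm f))"
proof -
  have "eqX N (sig f * f) (sig f * sig (sig f))"
    by (intro eqX_mult eqX_refl eqX_sym[OF sig_sig])
  then show ?thesis by (simp add: norm_def sig_mult mult.commute)
qed

lemma val_norm_X: "val_is (2 * j) (norm fps_X ^ j)"
proof (induction j)
  case 0
  show ?case by (simp add: val_is_def eqX_def)
next
  case (Suc j)
  have "val_is 1 fps_X" by (simp add: val_is_def eqX_def)
  then have "val_is (1 + 1) (norm fps_X)"
    unfolding norm_def by (intro val_is_mult val_sig)
  from val_is_mult[OF this Suc] show ?case by simp
qed

lemma norm_inverse_cancel: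
  assumes "f $ 0 = 1"
  shows "norm (inverse f) * norm f = 1"
  using unit_inverse[OF assms] by (simp add: norm_mult[symmetric] mult.commute)

text \<open>The elements \<open>f / sig f\<close> have norm \<open>1\<close>. For \<open>f = 1 + X^(m - 1)\<close> with \<open>m - 1\<close> odd such an
element differs from \<open>1\<close> in order exactly \<open>m\<close>.\<close>

lemma kernel_even:
  assumes "2 \<le> m" "even m"
  shows "\<exists>\<rho>. val_is m (\<rho> + 1) \<and> eqX N (norm \<rho>) 1"
proof -
  define f :: "bit fps" where "f = 1 + fps_X ^ (m - 1)"
  have m: "Suc (m - 1) = m" "odd (m - 1)" using assms by auto
  have f0: "f $ 0 = 1" using m by (auto simp: f_def intro: Suc_lessI)
  define g where "g = inverse (sig f)"
  have g0: "g $ 0 = 1" using f0 by (simp add: g_def)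
  have gs: "sig f * g = 1" unfolding g_def by (rule unit_inverse) (simp add: f0)
  have "val_is (m - 1) (fps_X ^ (m - 1))" by (simp add: val_is_def eqX_def)
  from val_odd[OF this m(2)] have v: "val_is m (f + sig f)"
    unfolding m by (simp add: f_def sig_add sig_power algebra_simps)
  have "f * g + 1 = g * (f + sig f)" using gs by (simp add: algebra_simps)
  moreover have "val_is 0 g" using g0 by (simp add: val_is_def eqX_def)
  ultimately have "val_is m (f * g + 1)" using val_is_mult[OF _ v] by fastforce
  moreover have "eqX N (norm (f * g)) 1"
  proof -
    have sg: "sig (sig f) * sig g = 1" using gs by (simp flip: sig_mult)
    have "eqX N (f * sig g) (sig (sig f) * sig g)"
      by (intro eqX_mult eqX_refl eqX_sym[OF sig_sig])
    then have "eqX N (sig f * g * (f * sig g)) (1 * 1)"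
      unfolding sg gs by (intro eqX_mult eqX_refl)
    then show ?thesis by (simp add: norm_def sig_mult mult_ac)
  qed
  ultimately show ?thesis by blast
qed

lemma norm_one_plus: "norm (1 + r) = 1 + ((r + sig r) + norm r)"
  by (simp add: norm_def sig_add algebra_simps)

lemma kernel_high:
  assumes "M \<le> Suc m" "4 \<le> M"
  shows "\<exists>\<rho>. val_is m (\<rho> + 1) \<and> eqX M (norm \<rho>) 1"
proof (intro exI conjI)
  let ?r = "fps_X ^ m :: bit fps"
  have r: "val_is m ?r" by (simp add: val_is_def eqX_def)
  then show "val_is m ((1 + ?r) + 1)" by (simp add: add.commute)
  have "eqX M (?r + sig ?r) 0"
    using r sig_low(1)[of m ?r] assms by (auto simp: val_is_def intro: eqX_mono)
  moreover have "eqX M (norm ?r) 0"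
  proof -
    have "eqX (m + m) (norm ?r) 0"
      unfolding norm_def using r val_sig[OF r] by (intro eqX_mult_0) (auto simp: val_is_def)
    then show ?thesis by (rule eqX_mono) (use assms in auto)
  qed
  ultimately show "eqX M (norm (1 + ?r)) 1"
    unfolding norm_one_plus using eqX_add eqX_refl by (metis add.right_neutral)
qed

lemma norm_odd_val:
  assumes "val_is m r" "odd m" "3 \<le> m"
  shows "val_is (Suc m) (norm (1 + r) + 1)"
proof -
  have "eqX (m + m) (norm r) 0"
    unfolding norm_def using assms(1) val_sig[OF assms(1)] by (intro eqX_mult_0) (auto simp: val_is_def)
  then have "eqX (Suc (Suc m)) (norm r) 0" by (rule eqX_mono) (use assms in auto)
  moreover have "norm (1 + r) + 1 = (r + sig r) + norm r"
    by (simp add: norm_one_plus add.commute)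
  ultimately show ?thesis
    using val_odd[OF assms(1,2)] by (auto simp: val_is_def eqX_def)
qed

lemma kernel_odd:
  assumes "val_is m (\<rho> + 1)" "odd m" "3 \<le> m" "Suc m < M"
  shows "\<not> eqX M (norm \<rho>) 1"
proof
  assume "eqX M (norm \<rho>) 1"
  moreover have "1 + (\<rho> + 1) = \<rho>" by (simp add: add.commute)
  ultimately have "eqX M (norm (1 + (\<rho> + 1)) + 1) 0" by (simp add: eqX_add_iff)
  with not_eqX_val[OF norm_odd_val[OF assms(1-3)]] assms(4) show False by simp
qed

text \<open>Successive approximation: if \<open>norm q\<close> and \<open>g\<close> agree up to order \<open>M\<close> exactly, then \<open>M\<close> is even,
as both are symmetric and \<open>M + 1 < N\<close>, and multiplying \<open>q\<close> by \<open>1 + X^(M - 1)\<close>, whose norm is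
\<open>1 + X^M + \<dots>\<close>, repairs the discrepancy. The method stops short of \<open>M = N\<close> because a symmetric
discrepancy of order \<open>N - 1\<close> cannot be removed in this way. The condition \<open>q \<equiv> 1\<close>
modulo \<open>X^2\<close> allows the result to be combined with \<open>a\<close> without losing the linear term.\<close>

lemma norm_approx:
  assumes g: "eqX N g (sig g)" "eqX 3 g 1" and M: "M < N"
  shows "\<exists>q. eqX 2 q 1 \<and> eqX M (norm q) g"
  using M
proof (induction M)
  case 0
  show ?case by (intro exI[of _ 1]) (simp add: eqX_def)
next
  case (Suc M)
  then obtain q where q: "eqX 2 q 1" "eqX M (norm q) g" by auto
  consider "Suc M \<le> 3" | "norm q $ M = g $ M" | "3 \<le> M" "norm q $ M \<noteq> g $ M" by linarith
  then show ?case
  proof cases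
    case 1
    then show ?thesis
      using eqX_mono[OF g(2)] by (intro exI[of _ 1]) (auto intro: eqX_sym)
  next
    case 2
    then show ?thesis using q by (auto simp: eqX_Suc)
  next
    case 3
    define d where "d = norm q + g"
    have dM: "d $ M = 1"
      using 3 unfolding d_def by (cases "norm q $ M"; cases "g $ M") auto
    have "val_is M d"
      using q(2) dM by (simp add: val_is_def d_def eqX_add_iff)
    moreover have "eqX N d (sig d)"
      unfolding d_def sig_add by (intro eqX_add norm_symmetric g)
    ultimately have "even M" using symmetric_val[of N d M] Suc.prems by auto
    define r :: "bit fps" where "r = fps_X ^ (M - 1)"
    define w where "w = norm (1 + r) + 1"
    have "odd (M - 1)" "3 \<le> M - 1" "Suc (M - 1) = M" using \<open>even M\<close> \<open>3 \<le> M\<close> by presburger+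
    moreover have "val_is (M - 1) r" by (simp add: r_def val_is_def eqX_def)
    ultimately have w: "val_is M w"
      using norm_odd_val[of "M - 1" r] by (simp add: w_def)
    \<comment> \<open>Since \<open>norm q\<close> has constant term \<open>1\<close>, the factor \<open>1 + w\<close> alters its coefficient at \<open>M\<close> and none below.\<close>
    have "val_is 0 (norm q)" using q(1) by (simp add: val_is_def norm_0_nth eqX_def)
    from val_is_mult[OF this w] have v: "val_is M (norm q * w)" by simp
    have "norm q + norm q * w = norm q * norm (1 + r)"
      unfolding w_def distrib_left by (simp add: add.commute)
    then have eq: "norm (q * (1 + r)) = norm q + norm q * w"
      by (simp only: norm_mult)
    have "eqX M (norm (q * (1 + r))) (g + 0)"
      unfolding eq using v q(2) by (intro eqX_add) (auto simp: val_is_def)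
    moreover have "norm (q * (1 + r)) $ M = g $ M"
      unfolding eq using v 3(2)
      by (cases "norm q $ M"; cases "g $ M") (auto simp: val_is_def)
    moreover have "eqX 2 (q * (1 + r)) (1 * (1 + 0))"
      using q(1) \<open>3 \<le> M - 1\<close> by (intro eqX_mult eqX_add) (auto simp: r_def eqX_def)
    ultimately show ?thesis
      by (intro exI[of _ "q * (1 + r)"]) (auto simp: eqX_Suc)
  qed
qed

end

section \<open>The coefficient of the central involution\<close>

abbreviation gen_a :: "bit fps" where "gen_a \<equiv> 1 + fps_X"

lemma gen_a_pow_nth: "(gen_a ^ m) $ j = of_nat (m choose j)"
proof (induction m arbitrary: j)
  case 0
  then show ?case by (cases j) auto
next
  case (Suc m)
  show ?case
  proof (cases j)
    case 0
    then show ?thesis by (simp add: fps_power_zeroth)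
  next
    case j: (Suc i)
    have "(gen_a ^ Suc m) $ j = (gen_a ^ m) $ Suc i + (gen_a ^ m) $ i"
      unfolding j power_Suc distrib_right by simp
    also have "\<dots> = of_nat ((m choose i) + (m choose Suc i))"
      unfolding Suc.IH of_nat_add by (rule add.commute)
    finally show ?thesis by (simp only: j binomial_Suc_Suc)
  qed
qed

lemma gen_a_pow_nth_high: "m < j \<Longrightarrow> (gen_a ^ m) $ j = 0"
  by (simp add: gen_a_pow_nth binomial_eq_0)

text \<open>The series whose coordinates in the basis \<open>1, a, \<dots>, a^(N - 1)\<close> are the coefficients of \<open>f\<close>.
As \<open>a = 1 + X\<close> and \<open>X = 1 + a\<close>, this change of basis is its own inverse.\<close>

definition a_poly :: "nat \<Rightarrow> bit fps \<Rightarrow> bit fps" where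
  "a_poly N f = (\<Sum>i<N. fps_const (f $ i) * gen_a ^ i)"

lemma a_poly_add: "a_poly N (f + g) = a_poly N f + a_poly N g"
  by (simp add: a_poly_def sum.distrib distrib_right fps_const_add[symmetric] del: fps_const_add)

lemma a_poly_0: "a_poly N 0 = 0"
  by (simp add: a_poly_def)

lemma a_poly_sum: "a_poly N (sum f I) = (\<Sum>i\<in>I. a_poly N (f i))"
  by (induction I rule: infinite_finite_induct) (simp_all add: a_poly_add a_poly_0)

lemma a_poly_const: "a_poly N (fps_const b * f) = fps_const b * a_poly N f"
  by (simp add: a_poly_def sum_distrib_left mult.assoc[symmetric])

lemma a_poly_in [simp]: "a_poly N f \<in> trunc_set N"
  by (auto simp: trunc_set_def a_poly_def fps_sum_nth gen_a_pow_nth_high)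

lemma a_poly_gen_a: "k < N \<Longrightarrow> a_poly N (gen_a ^ k) = fps_X ^ k"
proof -
  assume "k < N"
  have "a_poly N (gen_a ^ k) = (\<Sum>i<N. of_nat (k choose i) * gen_a ^ i)"
    unfolding a_poly_def gen_a_pow_nth by (simp add: fps_of_nat)
  also have "\<dots> = (\<Sum>i\<le>k. of_nat (k choose i) * gen_a ^ i)"
    using \<open>k < N\<close> by (intro sum.mono_neutral_right) (auto simp: binomial_eq_0)
  also have "\<dots> = (gen_a + 1) ^ k"
    unfolding binomial_ring[of gen_a 1 k] by simp
  finally show ?thesis by (simp add: add.commute)
qed

lemma a_poly_a_poly: "a_poly N (a_poly N f) = fps_cutoff N f"
proof -
  have "a_poly N (a_poly N f) = (\<Sum>i<N. fps_const (f $ i) * fps_X ^ i)"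
    by (subst (2) a_poly_def) (simp add: a_poly_sum a_poly_const a_poly_gen_a)
  also have "\<dots> = fps_cutoff N f"
    by (simp add: fps_eq_iff fps_sum_nth if_distrib cong: if_cong)
  finally show ?thesis .
qed

lemma basis_induct:
  assumes "P 0" "\<And>i f. i < N \<Longrightarrow> P f \<Longrightarrow> P (f + gen_a ^ i)" "\<And>f g. eqX N f g \<Longrightarrow> P f \<Longrightarrow> P g"
  shows "P f"
proof -
  have "P (\<Sum>i\<in>I. fps_const (g i) * gen_a ^ i)" if "finite I" "I \<subseteq> {..<N}" for I and g :: "nat \<Rightarrow> bit"
    using that
  proof (induction I)
    case empty
    then show ?case by (simp add: assms(1))
  next
    case (insert j J)
    then show ?case
      using assms(2)[of j "\<Sum>i\<in>J. fps_const (g i) * gen_a ^ i"]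
      by (cases "g j") (auto simp: add.commute)
  qed
  then have "P (a_poly N (a_poly N f))"
    by (subst a_poly_def) auto
  then show ?thesis unfolding a_poly_a_poly by (rule assms(3)[OF cutoff_eqX])
qed

context maximal_class
begin

lemma two_p: "2 * p = 2 ^ (n - 1)"
proof -
  have "4 * p = 2 ^ n" unfolding N_p[symmetric] by (rule N_eq)
  then show ?thesis using n2 by (cases n) auto
qed

lemma gen_a_pow_2p: "gen_a ^ (2 * p) = 1 + fps_X ^ (2 * p)"
  unfolding two_p fps_bit_pow2_add by simp

lemma gen_a_mod: "eqX N (gen_a ^ m) (gen_a ^ (m mod N))"
proof -
  have "gen_a ^ m = gen_a ^ (N * (m div N)) * gen_a ^ (m mod N)"
    by (simp flip: power_add)
  moreover have "eqX N (gen_a ^ (N * (m div N)) * gen_a ^ (m mod N)) (1 * gen_a ^ (m mod N))"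
    by (intro eqX_mult pow_N_mult eqX_refl)
  ultimately show ?thesis by simp
qed

text \<open>The coefficient of \<open>a^(N/2)\<close> in the basis of powers of \<open>a\<close>, the central involution of the three
groups (see \<open>lam_gen_a\<close>). It supplies the obstruction at \<open>M = N\<close> that distinguishes them:
applied to norms it is additive, so its values there are determined by the powers of \<open>a\<close>.\<close>

definition lam :: "bit fps \<Rightarrow> bit" where
  "lam f = (\<Sum>j\<in>{2 * p..<N}. f $ j)"

lemma lam_eqX: "eqX N f g \<Longrightarrow> lam f = lam g"
  by (simp add: lam_def eqX_def)
lemma lam_add: "lam (f + g) = lam f + lam g"
  by (simp add: lam_def sum.distrib)
lemma lam_0: "lam 0 = 0"
  by (simp add: lam_def)

text \<open>For \<open>m = 2 p + r\<close> with \<open>r < 2 p\<close> the factor \<open>a^(2 p) = 1 + X^(2 p)\<close> copies the coefficients of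
\<open>a^r\<close> into the range of summation. Their sum is the value \<open>2^r\<close> of \<open>(1 + X)^r\<close> at \<open>1\<close>, which is odd
only for \<open>r = 0\<close>.\<close>

lemma lam_gen_a: "lam (gen_a ^ m) = of_bool (m mod N = 2 * p)"
proof -
  have "lam (gen_a ^ m) = of_bool (m = 2 * p)" if "m < N" for m
  proof (cases "m < 2 * p")
    case True
    then show ?thesis by (simp add: lam_def gen_a_pow_nth_high)
  next
    case False
    then obtain r where r: "m = 2 * p + r" using le_Suc_ex not_less by blast
    then have "r < 2 * p" using that N_p by simp
    have "lam (gen_a ^ m) = (\<Sum>j\<in>{2 * p..<N}. (gen_a ^ r) $ (j - 2 * p))"
      unfolding lam_def r power_add gen_a_pow_2p using \<open>r < 2 * p\<close>
      by (intro sum.cong) (auto simp: distrib_right fps_X_power_mult_nth gen_a_pow_nth_high)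
    also have "\<dots> = (\<Sum>i<2 * p. (gen_a ^ r) $ i)"
      by (rule sum.reindex_bij_witness[of _ "\<lambda>i. i + 2 * p" "\<lambda>j. j - 2 * p"]) (auto simp: N_p)
    also have "\<dots> = (\<Sum>i\<le>r. (gen_a ^ r) $ i)"
      using \<open>r < 2 * p\<close> by (intro sum.mono_neutral_right) (auto simp: gen_a_pow_nth_high)
    also have "\<dots> = of_nat (\<Sum>i\<le>r. r choose i)"
      by (simp add: gen_a_pow_nth)
    also have "\<dots> = of_bool (r = 0)"
      by (simp add: choose_row_sum of_nat_bit)
    finally show ?thesis by (simp add: r)
  qed
  moreover have "m mod N < N" using N_p p_pos by simp
  ultimately show ?thesis using lam_eqX[OF gen_a_mod[of m]] by simp
qed

lemma sig_gen_a_pow: "sig (gen_a ^ m) = gen_a ^ (e * m)"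
  by (simp add: sig_power sig_a power_mult)

lemma mult_e_2p: "(e * m) mod N = 2 * p \<longleftrightarrow> m mod N = 2 * p"
proof -
  have *: "(e * k) mod N = 2 * p" if "k mod N = 2 * p" for k
  proof -
    obtain d where d: "e = 2 * d + 1" using e_odd by (elim oddE)
    have "(e * k) mod N = (e * (k mod N)) mod N" by (simp add: mod_mult_right_eq)
    also have "e * (k mod N) = 2 * p + N * d" unfolding that d by (simp add: N_p algebra_simps)
    also have "\<dots> mod N = 2 * p" using N_p p_pos by simp
    finally show ?thesis .
  qed
  obtain r where r: "e * e = 1 + N * r" using e_square by blast
  have "(e * (e * m)) mod N = m mod N"
  proof -
    have "e * (e * m) = (1 + N * r) * m" unfolding r[symmetric] by simp
    also have "\<dots> = m + N * (r * m)" by (simp add: algebra_simps)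
    finally show ?thesis by simp
  qed
  then show ?thesis using *[of m] *[of "e * m"] by auto
qed

lemma lam_sig: "lam (sig f) = lam f"
proof (induction f rule: basis_induct[of _ N])
  case (2 i f)
  then show ?case
    by (simp only: sig_add lam_add sig_gen_a_pow lam_gen_a mult_e_2p)
next
  case (3 f g)
  then show ?case by (simp only: lam_eqX[OF 3(1)] lam_eqX[OF sig_eqX[OF 3(1)]])
qed simp

text \<open>The mixed terms \<open>f sig g\<close> and \<open>g sig f\<close> are exchanged by \<open>sig\<close>, which preserves the coefficient
of \<open>a^(N/2)\<close>; in characteristic two their contributions cancel.\<close>

lemma lam_norm_add: "lam (norm (f + g)) = lam (norm f) + lam (norm g)"
proof -
  have "eqX N (sig (f * sig g)) (g * sig f)"
    using eqX_mult[OF eqX_refl sig_sig, of "sig f" g] by (simp add: sig_mult mult.commute)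
  from lam_eqX[OF this] have "lam (f * sig g) = lam (g * sig f)"
    by (simp only: lam_sig)
  then have "lam (f * sig g) + lam (g * sig f) = 0"
    by (cases "lam (g * sig f)") simp_all
  moreover have "norm (f + g) = norm f + norm g + (f * sig g + g * sig f)"
    by (simp add: norm_def sig_add algebra_simps)
  ultimately show ?thesis by (simp only: lam_add add_0_right)
qed

lemma lam_norm_gen_a: "lam (norm (gen_a ^ i)) = of_bool ((i * (1 + e)) mod N = 2 * p)"
  by (simp only: norm_def sig_gen_a_pow power_add[symmetric] lam_gen_a)
     (simp add: algebra_simps)

lemma lam_norm_inverting:
  assumes e: "e = N - 1"
  shows "lam (norm f) = 0"
proof (induction f rule: basis_induct[of _ N])
  case (2 i f)
  have "1 + e = N" using e N_p p_pos by simp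
  then have "\<not> (i * (1 + e)) mod N = 2 * p" using p_pos by simp
  with 2 show ?case by (simp add: lam_norm_add lam_norm_gen_a)
next
  case (3 f g)
  then show ?case by (simp only: lam_eqX[OF norm_eqX[OF 3(1)]])
qed (simp add: norm_def lam_0)

lemma lam_norm_semi:
  assumes e: "e = 2 * p - 1"
  shows "lam (norm f) = f $ 1"
proof (induction f rule: basis_induct[of _ N])
  case (2 i f)
  have "1 + e = 2 * p" using e p_pos by simp
  have "N = 2 * p * 2" using N_p by simp
  then have "(i * (2 * p)) mod N = 2 * p * (i mod 2)"
    by (simp only: mult_mod_right mult.commute[of i])
  then have "((i * (1 + e)) mod N = 2 * p) = odd i"
    using \<open>1 + e = 2 * p\<close> p_pos by (cases "even i") (auto simp: odd_iff_mod_2_eq_one)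
  moreover have "(gen_a ^ i) $ 1 = of_nat i" by (simp add: gen_a_pow_nth)
  ultimately show ?case using 2 by (simp only: lam_norm_add lam_norm_gen_a fps_add_nth of_nat_bit)
next
  case (3 f g)
  have "1 < N" using N_p p_pos by simp
  then have "f $ 1 = g $ 1" using 3(1) unfolding eqX_def by blast
  with 3 show ?case by (simp only: lam_eqX[OF norm_eqX[OF 3(1)]])
qed (simp add: norm_def lam_0)

lemma lam_1: "lam 1 = 0"
  using lam_gen_a[of 0] p_pos by simp

lemma kernel_not_one:
  assumes "e = 2 * p - 1" "eqX N (norm \<rho>) 1"
  shows "\<rho> $ 1 = 0"
  using lam_norm_semi[OF assms(1), of \<rho>] lam_eqX[OF assms(2)] lam_1 by simp

lemma not_norm:
  assumes "e = N - 1"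
  shows "\<not> eqX N (norm q) (gen_a ^ (2 * p))"
proof
  assume "eqX N (norm q) (gen_a ^ (2 * p))"
  from lam_eqX[OF this] lam_norm_inverting[OF assms] lam_gen_a[of "2 * p"] N_p show False by simp
qed

lemma norm_gen_a: "norm gen_a = gen_a ^ (1 + e)"
  by (simp only: norm_def sig_a power_add power_one_right)

text \<open>The natural candidate is \<open>a\<close> itself, of norm \<open>a^(1 + e)\<close>. If \<open>e = N - 1\<close> this is \<open>1\<close>; otherwise
it is congruent to \<open>1\<close> modulo \<open>X^4\<close>, and it can be divided out by means of \<open>norm_approx\<close> as long
as \<open>M < N\<close>.\<close>

lemma kernel_one:
  assumes "M < N \<or> M = N \<and> e = N - 1"
  shows "\<exists>\<rho>. val_is 1 (\<rho> + 1) \<and> eqX M (norm \<rho>) 1"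
  using assms
proof (elim disjE conjE)
  assume "M = N" "e = N - 1"
  then have "1 + e = N" using N_p p_pos by simp
  then have "eqX M (norm gen_a) 1"
    using gen_a_mod[of N] \<open>M = N\<close> by (simp add: norm_gen_a)
  moreover have "val_is 1 (gen_a + 1)" by (simp add: val_is_def eqX_def add.commute)
  ultimately show ?thesis by blast
next
  assume M: "M < N"
  have "eqX 4 (norm gen_a) (gen_a * (1 + fps_X + fps_X^2 + fps_X^3))"
    unfolding norm_def sig_a by (intro eqX_mult eqX_refl one_plus_X_e)
  also have "gen_a * (1 + fps_X + fps_X^2 + fps_X^3) = 1 + fps_X ^ 4"
    by (simp add: algebra_simps power2_eq_square power3_eq_cube power4_eq_xxxx)
  also have "eqX 4 (1 + fps_X ^ 4) 1" by (simp add: eqX_def)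
  finally have "eqX 3 (norm gen_a) 1" by (rule eqX_mono) simp
  from norm_approx[OF norm_symmetric this M] obtain q where
    q: "eqX 2 q 1" "eqX M (norm q) (norm gen_a)" by blast
  have q0: "q $ 0 = 1" "q $ 1 = 0" using q(1) by (auto simp: eqX_def)
  define \<rho> where "\<rho> = inverse q * gen_a"
  have "q * \<rho> = gen_a" using unit_inverse[OF q0(1)] by (simp add: \<rho>_def mult.assoc[symmetric])
  then have "(q * \<rho>) $ 1 = 1" "(q * \<rho>) $ 0 = 1" by simp_all
  then have "\<rho> $ 0 = 1" "\<rho> $ 1 = 1" using q0 by (simp_all add: fps_mult_nth)
  then have "val_is 1 (\<rho> + 1)" by (simp add: val_is_def eqX_def)
  moreover have "eqX M (norm \<rho>) 1"
  proof -
    have "eqX M (norm (inverse q) * norm q) (norm (inverse q) * norm gen_a)"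
      by (intro eqX_mult eqX_refl q)
    then show ?thesis unfolding norm_inverse_cancel[OF q0(1)] \<rho>_def norm_mult by (rule eqX_sym)
  qed
  ultimately show ?thesis by blast
qed

lemma pow_c_square: "eqX N (gen_a ^ c * gen_a ^ c) 1"
proof -
  have "c + c = 0 \<or> c + c = N" using c_cases N_p by auto
  then show ?thesis using gen_a_mod[of N] by (auto simp flip: power_add)
qed

lemma norm_exists:
  assumes "M < N \<or> c = 0" "M \<noteq> N \<longrightarrow> 8 \<le> N"
  shows "\<exists>q. q $ 0 = 1 \<and> eqX M (norm q) (gen_a ^ c)"
proof (cases "c = 0")
  case True
  then show ?thesis by (intro exI[of _ 1]) simp
next
  case False
  then have c: "c = 2 * p" "M < N" using c_cases N_p assms by auto
  have "eqX N (gen_a ^ c) (sig (gen_a ^ c))"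
  proof -
    have "(e * c) mod N = c mod N" using mult_e_2p[of c] c N_p by simp
    then show ?thesis using gen_a_mod[of "e * c"] gen_a_mod[of c]
      by (metis eqX_sym eqX_trans sig_gen_a_pow)
  qed
  moreover have "eqX 3 (gen_a ^ c) 1"
    using assms c N_p unfolding c gen_a_pow_2p by (auto simp: eqX_def)
  ultimately obtain q where "eqX 2 q 1" "eqX M (norm q) (gen_a ^ c)"
    using norm_approx c by blast
  moreover from this have "q $ 0 = 1" by (simp add: eqX_def)
  ultimately show ?thesis by blast
qed

end

section \<open>Counting the solutions\<close>

lemma finite_trunc_set: "finite (trunc_set N)"
  and card_trunc_val: "card {f \<in> trunc_set N. eqX m f 0} = 2 ^ (N - m)"
proof -
  have card: "card {f \<in> trunc_set N. eqX m f 0} = 2 ^ card {m..<N}" for m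
  proof (rule card_branching)
    have "0 \<in> trunc_set N" by (simp add: trunc_set_def)
    then have "0 \<in> {f \<in> trunc_set N. eqX m f 0}" by simp
    then show "{f \<in> trunc_set N. eqX m f 0} \<noteq> {}" by blast
  next
    fix j w assume j: "j \<in> {m..<N}" and w: "w \<in> {f \<in> trunc_set N. eqX m f 0}"
    show "\<exists>w'\<in>{f \<in> trunc_set N. eqX m f 0}. eqX j w w' \<and> w $ j \<noteq> w' $ j"
      using j w
      by (intro bexI[of _ "w + fps_X ^ j"]; cases "w $ j") (auto simp: eqX_def trunc_set_def)
  qed (auto simp: eqX_def)
  then show "card {f \<in> trunc_set N. eqX m f 0} = 2 ^ (N - m)" by simp
  have "card {f \<in> trunc_set N. eqX 0 f 0} > 0" unfolding card by simp
  then show "finite (trunc_set N)" by (simp add: eqX_def card_ge_0_finite)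
qed

lemma val_is_eqX:
  "val_is k f \<Longrightarrow> eqX m f g \<Longrightarrow> k < m \<Longrightarrow> val_is k g"
  by (auto simp: val_is_def eqX_def)

lemma val_is_add_iff: "val_is m (f + g) \<longleftrightarrow> eqX m f g \<and> f $ m \<noteq> g $ m"
  unfolding val_is_def eqX_add_iff by (cases "f $ m"; cases "g $ m") auto

lemma val_is_0_iff: "val_is 0 f \<longleftrightarrow> f $ 0 = 1"
  by (simp add: val_is_def eqX_def)

lemma val_is_times_unit: "val_is k f \<Longrightarrow> u $ 0 = 1 \<Longrightarrow> val_is k (u * f)"
  using val_is_mult[of 0 u k f] by (simp add: val_is_0_iff)

lemma eqX_val_cancel:
  assumes "val_is k y" "k \<le> m"
  shows "eqX m (y * f) (y * g) \<longleftrightarrow> eqX (m - k) f g"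
proof -
  obtain u where u: "u $ 0 = 1" "y = fps_X ^ k * u" using assms(1) val_is_iff by blast
  have "eqX m (y * f) (y * g) \<longleftrightarrow> eqX (k + (m - k)) (fps_X ^ k * (u * f)) (fps_X ^ k * (u * g))"
    using assms(2) by (simp add: u(2) mult.assoc)
  then show ?thesis by (simp only: eqX_mult_X_iff eqX_unit_cancel[OF u(1)])
qed

lemma val_quotient:
  assumes "val_is k y" "val_is k v"
  obtains q where "q $ 0 = 1" "v = q * y"
proof -
  obtain a where a: "a $ 0 = 1" "y = fps_X ^ k * a" using assms(1) val_is_iff by blast
  obtain b where b: "b $ 0 = 1" "v = fps_X ^ k * b" using assms(2) val_is_iff by blast
  have "v = (b * inverse a) * y"
    using unit_inverse[OF a(1)] by (simp add: a b algebra_simps)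
  moreover have "(b * inverse a) $ 0 = 1" using a b by simp
  ultimately show ?thesis using that by blast
qed

context maximal_class
begin

text \<open>The element \<open>1 + y + v b\<close> of the group algebra squares to \<open>1\<close> if and only if \<open>y\<close> and \<open>v\<close> satisfy
these two equations (see \<open>square_one_iff\<close>): they are the \<open>a\<close>-component and the
\<open>b\<close>-component of \<open>(y + v b)^2 = 0\<close>.\<close>

definition sol :: "bit fps \<Rightarrow> bit fps \<Rightarrow> bool" where
  "sol y v \<longleftrightarrow> eqX N (y\<^sup>2) (gen_a ^ c * norm v) \<and> eqX N (v * (y + sig y)) 0"

lemma sol_eqX: "eqX N y y' \<Longrightarrow> eqX N v v' \<Longrightarrow> sol y v \<Longrightarrow> sol y' v'"
  unfolding sol_def
proof (elim conjE, intro conjI)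
  assume y: "eqX N y y'" and v: "eqX N v v'"
  show "eqX N (y'\<^sup>2) (gen_a ^ c * norm v')" if "eqX N (y\<^sup>2) (gen_a ^ c * norm v)"
    using eqX_trans[OF eqX_trans[OF eqX_sym[OF eqX_power[OF y]] that] eqX_mult[OF eqX_refl norm_eqX[OF v]]] .
  show "eqX N (v' * (y' + sig y')) 0" if "eqX N (v * (y + sig y)) 0"
    using eqX_trans[OF eqX_sym[OF eqX_mult[OF v eqX_add[OF y sig_eqX[OF y]]]] that] .
qed

lemma val_norm: "val_is k f \<Longrightarrow> val_is (2 * k) (norm f)"
  unfolding norm_def using val_is_mult[OF _ val_sig] by (metis mult_2)

lemma norm_high: "eqX (2 * p) f 0 \<Longrightarrow> eqX N (norm f) 0"
  using eqX_mult_0[of "2 * p" f "2 * p" "sig f"] sig_eqX[of "2 * p" f 0]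
  by (simp add: norm_def N_p)

lemma sq_high: "eqX (2 * p) f 0 \<Longrightarrow> eqX N (f\<^sup>2) 0"
  using eqX_mult_0[of "2 * p" f "2 * p" f] by (simp add: power2_eq_square N_p)

lemma gen_a_pow_0: "(gen_a ^ k) $ 0 = 1"
  by (simp add: gen_a_pow_nth)

lemma sol_high:
  assumes "eqX (2 * p) y 0"
  shows "sol y v \<longleftrightarrow> eqX (2 * p) v 0"
proof
  assume v: "eqX (2 * p) v 0"
  have "eqX N (gen_a ^ c * norm v) (gen_a ^ c * 0)"
    by (intro eqX_mult eqX_refl norm_high v)
  then have "eqX N (y\<^sup>2) (gen_a ^ c * norm v)"
    using sq_high[OF assms] by (auto intro: eqX_trans eqX_sym)
  moreover have "eqX (2 * p) (y + sig y) 0"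
    using eqX_add[OF assms sig_eqX[OF assms]] by simp
  then have "eqX N (v * (y + sig y)) 0"
    using eqX_mult_0[OF v, of "2 * p" "y + sig y"] by (simp add: N_p)
  ultimately show "sol y v" by (simp add: sol_def)
next
  assume s: "sol y v"
  show "eqX (2 * p) v 0"
    using ex_val[of "2 * p" v]
  proof (elim disjE exE conjE)
    fix k assume k: "k < 2 * p" "val_is k v"
    have "val_is (2 * k) (gen_a ^ c * norm v)"
      by (intro val_is_times_unit val_norm k gen_a_pow_0)
    moreover have "eqX N (gen_a ^ c * norm v) 0"
      using s sq_high[OF assms] unfolding sol_def by (blast intro: eqX_trans eqX_sym)
    ultimately have "N \<le> 2 * k" by (simp add: not_eqX_val)
    then show ?thesis using k by (simp add: N_p)
  qed
qed

text \<open>The first equation forces \<open>v\<close> to vanish to the same order as \<open>y\<close>, so \<open>v = q y\<close> with a unit \<open>q\<close>. The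
second equation then says that \<open>y\<close> is symmetric modulo \<open>X^(N - k)\<close>, whence
\<open>y^2 \<equiv> norm y\<close>, and the first one becomes \<open>y^2 \<equiv> a^c (norm q) y^2\<close>, where \<open>y^2\<close> can be
cancelled. In this form the conditions on \<open>y\<close> and on \<open>q\<close> are independent.\<close>

lemma sol_iff:
  assumes y: "val_is k y" and k: "k < 2 * p"
  shows "sol y v \<longleftrightarrow> eqX (N - k) y (sig y) \<and>
    (\<exists>q. q $ 0 = 1 \<and> v = q * y \<and> eqX (N - 2 * k) (norm q) (gen_a ^ c))"
proof -
  have kN: "2 * k < N" "k < N" using k by (simp_all add: N_p)
  have vy2: "val_is (2 * k) (y\<^sup>2)"
    using val_is_mult[OF y y] by (simp add: power2_eq_square mult_2)
  have main: "sol y (q * y) \<longleftrightarrow> eqX (N - 2 * k) (norm q) (gen_a ^ c)"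
    if q: "q $ 0 = 1" and sy: "eqX (N - k) y (sig y)" for q
  proof -
    have z: "eqX N (y * y) (y * sig y)"
      using sy kN by (simp add: eqX_val_cancel[OF y])
    then have "eqX N (y\<^sup>2) (norm y)" by (simp add: norm_def power2_eq_square)
    then have e1: "eqX N (y\<^sup>2 * (gen_a ^ c * norm q)) (norm y * (gen_a ^ c * norm q))"
      by (intro eqX_mult eqX_refl)
    have e2: "gen_a ^ c * norm (q * y) = norm y * (gen_a ^ c * norm q)"
      by (simp add: norm_mult mult_ac)
    have second: "eqX N (q * y * (y + sig y)) 0"
    proof -
      have "eqX N (y * y + y * sig y) 0" using z by (simp add: eqX_add_iff)
      from eqX_mult[OF eqX_refl this] show ?thesis
        by (metis distrib_left mult.assoc mult_zero_right)
    qed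
    have "sol y (q * y) \<longleftrightarrow> eqX N (y\<^sup>2 * 1) (y\<^sup>2 * (gen_a ^ c * norm q))"
      unfolding sol_def e2 using second eqX_trans[OF _ eqX_sym[OF e1]] eqX_trans[OF _ e1] by auto
    also have "\<dots> \<longleftrightarrow> eqX (N - 2 * k) 1 (gen_a ^ c * norm q)"
      using kN by (simp only: eqX_val_cancel[OF vy2] less_imp_le)
    also have "\<dots> \<longleftrightarrow> eqX (N - 2 * k) (gen_a ^ c * gen_a ^ c) (gen_a ^ c * norm q)"
      using eqX_mono[OF pow_c_square, of "N - 2 * k"] by (auto intro: eqX_trans eqX_sym)
    also have "\<dots> \<longleftrightarrow> eqX (N - 2 * k) (gen_a ^ c) (norm q)"
      by (rule eqX_unit_cancel) (rule gen_a_pow_0)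
    finally show ?thesis by (blast intro: eqX_sym)
  qed
  have "val_is k v \<and> eqX (N - k) y (sig y)" if s: "sol y v"
  proof -
    have a: "eqX N (y\<^sup>2) (gen_a ^ c * norm v)" using s by (simp add: sol_def)
    have "val_is (2 * k) (gen_a ^ c * norm v)" by (rule val_is_eqX[OF vy2 a kN(1)])
    have "\<not> eqX (2 * p) v 0"
    proof
      assume "eqX (2 * p) v 0"
      then have "eqX N (gen_a ^ c * norm v) (gen_a ^ c * 0)"
        by (intro eqX_mult eqX_refl norm_high)
      then have "eqX N (y\<^sup>2) 0" using a by (auto intro: eqX_trans)
      then show False using vy2 kN by (simp add: not_eqX_val)
    qed
    then obtain l where l: "val_is l v" using ex_val[of "2 * p" v] by blast
    have "val_is (2 * l) (gen_a ^ c * norm v)"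
      by (intro val_is_times_unit val_norm l gen_a_pow_0)
    then have "l = k"
      using \<open>val_is (2 * k) (gen_a ^ c * norm v)\<close> val_is_unique by fastforce
    then have v: "val_is k v" using l by simp
    have "eqX N (v * (y + sig y)) (v * 0)" using s by (simp add: sol_def)
    then have "eqX (N - k) (y + sig y) 0" using kN by (simp only: eqX_val_cancel[OF v] less_imp_le)
    then show ?thesis using v by (simp add: eqX_add_iff)
  qed
  then show ?thesis using main val_quotient[OF y] by metis
qed

text \<open>The possible orders of \<open>\<rho> - 1\<close> for units \<open>\<rho>\<close> of norm \<open>1\<close> modulo \<open>X^M\<close>, including orders at or
above \<open>M\<close>.\<close>

definition kernel_levels :: "nat \<Rightarrow> nat set" where
  "kernel_levels M = {m. 0 < m \<and> (\<exists>\<rho>. val_is m (\<rho> + 1) \<and> eqX M (norm \<rho>) 1)}"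

text \<open>Two solutions \<open>q y\<close> and \<open>q' y\<close> differ by a unit \<open>q' / q\<close> of norm \<open>1\<close> modulo \<open>X^(N - 2 k)\<close>, and every
such unit transforms a solution into another. The branching indices are therefore the
kernel levels shifted by \<open>k\<close>, the order of vanishing of \<open>y\<close>.\<close>

lemma card_second_components:
  assumes y: "val_is k y" and k: "k < 2 * p" and ex: "sol y v\<^sub>0"
  shows "card {v \<in> trunc_set N. sol y v} = 2 ^ card {m \<in> kernel_levels (N - 2 * k). m < N - k}"
proof -
  let ?W = "{v \<in> trunc_set N. sol y v}"
  let ?K = "{m \<in> kernel_levels (N - 2 * k). m < N - k}"
  let ?V = "(\<lambda>m. k + m) ` ?K"
  have kN: "k < N" using k by (simp add: N_p)
  have sy: "eqX (N - k) y (sig y)" using ex sol_iff[OF y k] by blast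
  note sol_y = sol_iff[OF y k]
  have "card ?W = 2 ^ card ?V"
  proof (rule card_branching)
    have "sol y (fps_cutoff N v\<^sub>0)"
      by (rule sol_eqX[OF eqX_refl eqX_sym[OF cutoff_eqX] ex])
    then show "?W \<noteq> {}" using cutoff_in by blast
  next
    fix j w assume "j \<in> ?V" and w: "w \<in> ?W"
    then obtain m \<rho> where m: "j = k + m" "0 < m" "m < N - k" "val_is m (\<rho> + 1)"
        "eqX (N - 2 * k) (norm \<rho>) 1"
      by (auto simp: kernel_levels_def)
    have \<rho>0: "\<rho> $ 0 = 1"
      using m(2,4) by (cases "\<rho> $ 0") (auto simp: val_is_def eqX_def)
    obtain q where q: "q $ 0 = 1" "w = q * y" "eqX (N - 2 * k) (norm q) (gen_a ^ c)"
      using w sol_y[of w] by blast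
    have "eqX (N - 2 * k) (norm \<rho> * norm q) (1 * gen_a ^ c)"
      by (intro eqX_mult m q)
    then have "sol y (\<rho> * q * y)"
      unfolding sol_y using sy q(1) \<rho>0 by (intro conjI exI[of _ "\<rho> * q"]) (auto simp: norm_mult)
    then have s: "sol y (fps_cutoff N (\<rho> * w))"
      using sol_eqX[OF eqX_refl eqX_sym[OF cutoff_eqX], of y "\<rho> * w"] by (simp add: q(2) mult.assoc)
    have "val_is (k + m) (w * (\<rho> + 1))"
      using val_is_mult[OF val_is_times_unit[OF y q(1)] m(4)] by (simp add: q(2))
    then have "val_is j (w + \<rho> * w)" by (simp add: m(1) algebra_simps)
    moreover have "j < N" using m kN by simp
    ultimately have "eqX j w (fps_cutoff N (\<rho> * w))" "w $ j \<noteq> fps_cutoff N (\<rho> * w) $ j"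
      using eqX_sym[OF cutoff_eqX_le[of j N "\<rho> * w"]]
      by (auto simp: val_is_add_iff intro: eqX_trans)
    then show "\<exists>w'\<in>?W. eqX j w w' \<and> w $ j \<noteq> w' $ j"
      using s by (intro bexI[of _ "fps_cutoff N (\<rho> * w)"]) auto
  next
    fix j w w' assume j: "j < N" "j \<notin> ?V" and w: "w \<in> ?W" "w' \<in> ?W" "eqX j w w'"
    show "w $ j = w' $ j"
    proof (rule ccontr)
      assume neq: "w $ j \<noteq> w' $ j"
      obtain q where q: "q $ 0 = 1" "w = q * y" "eqX (N - 2 * k) (norm q) (gen_a ^ c)"
        using w sol_y[of w] by blast
      obtain q' where q': "q' $ 0 = 1" "w' = q' * y" "eqX (N - 2 * k) (norm q') (gen_a ^ c)"
        using w sol_y[of w'] by blast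
      have vj: "val_is j (w + w')" using w neq by (simp add: val_is_add_iff)
      have ww: "w + w' = y * (q + q')" by (simp add: q q' algebra_simps)
      have "\<not> eqX N (q + q') 0"
      proof
        assume "eqX N (q + q') 0"
        then have "eqX N (w + w') (y * 0)" unfolding ww by (intro eqX_mult eqX_refl)
        then show False using vj j(1) by (simp add: not_eqX_val)
      qed
      then obtain m where m: "val_is m (q + q')" using ex_val by blast
      have "j = k + m" using val_is_unique[OF vj] val_is_mult[OF y m] ww by simp
      have "m \<noteq> 0" using m q(1) q'(1) by (intro notI) (simp add: val_is_def)
      define \<rho> where "\<rho> = inverse q * q'"
      have iq: "inverse q * q = 1" using unit_inverse[OF q(1)] by (simp add: mult.commute)
      have "\<rho> + 1 = inverse q * (q + q')" using iq by (simp add: \<rho>_def algebra_simps)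
      then have "val_is m (\<rho> + 1)" using val_is_times_unit[OF m, of "inverse q"] q(1) by simp
      moreover have "eqX (N - 2 * k) (norm \<rho>) 1"
      proof -
        have "eqX (N - 2 * k) (norm (inverse q) * norm q') (norm (inverse q) * norm q)"
          using q(3) q'(3) by (intro eqX_mult eqX_refl) (blast intro: eqX_trans eqX_sym)
        then show ?thesis unfolding norm_inverse_cancel[OF q(1)] \<rho>_def norm_mult .
      qed
      ultimately have "m \<in> kernel_levels (N - 2 * k)" using \<open>m \<noteq> 0\<close> by (auto simp: kernel_levels_def)
      then show False using j \<open>j = k + m\<close> by auto
    qed
  qed (auto simp: kN less_diff_conv add.commute)
  also have "card ?V = card ?K" by (rule card_image) auto
  finally show ?thesis .
qed

definition first_components :: "nat \<Rightarrow> bit fps set" where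
  "first_components k = {y \<in> trunc_set N. val_is k y \<and> eqX (N - k) y (sig y)}"

lemma first_components_odd: "odd k \<Longrightarrow> k < 2 * p \<Longrightarrow> first_components k = {}"
proof -
  assume k: "odd k" "k < 2 * p"
  have False if "val_is k y" "eqX (N - k) y (sig y)" for y
  proof -
    have "N - k \<le> Suc k" using symmetric_val[OF that(2,1) k(1)] .
    then have "2 * (2 * p) \<le> 2 * k + 1" by (simp add: N_p)
    then show False using k(2) by simp
  qed
  then show ?thesis by (auto simp: first_components_def)
qed

text \<open>The branching indices above \<open>2 j\<close> are the even ones, realized by the powers of
\<open>norm X = X * sig X\<close>, and all those from \<open>N - 2 j - 1\<close> on, where symmetry modulo
\<open>X^(N - 2 j)\<close> imposes nothing. Their number does not depend on \<open>j\<close>.\<close>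

lemma card_first_components:
  assumes j: "j < p"
  shows "card (first_components (2 * j)) = 2 ^ (2 * p)"
proof -
  let ?W = "first_components (2 * j)"
  let ?V = "(\<lambda>i. 2 * i) ` {Suc j..<2 * p - j} \<union> {4 * p - 2 * j - 1..<4 * p}"
  have step: "\<exists>d. val_is m d \<and> eqX (N - 2 * j) d (sig d)" if "even m \<or> N - 2 * j \<le> Suc m" for m
    using that
  proof
    assume "even m"
    then obtain i where i: "m = 2 * i" by (elim evenE)
    have "eqX N (norm fps_X ^ i) (sig (norm fps_X ^ i))"
      using norm_symmetric[of "fps_X ^ i"] by (simp add: norm_power)
    then have "eqX (N - 2 * j) (norm fps_X ^ i) (sig (norm fps_X ^ i))"
      by (rule eqX_mono) simp
    then show ?thesis using val_norm_X i by blast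
  next
    assume "N - 2 * j \<le> Suc m"
    moreover have "val_is m (fps_X ^ m)" by (simp add: val_is_def eqX_def)
    moreover from this have "eqX (Suc m) (fps_X ^ m) (sig (fps_X ^ m))"
      by (intro sig_eqX_Suc) (simp add: val_is_def)
    ultimately show ?thesis using eqX_mono by blast
  qed
  have cut: "fps_cutoff N f \<in> ?W" if "val_is (2 * j) f" "eqX (N - 2 * j) f (sig f)" for f
  proof -
    have c: "eqX (N - 2 * j) f (fps_cutoff N f)" by (rule eqX_sym, rule cutoff_eqX_le) simp
    have "eqX (N - 2 * j) (fps_cutoff N f) (sig (fps_cutoff N f))"
      using eqX_trans[OF eqX_trans[OF eqX_sym[OF c] that(2)] sig_eqX[OF c]] .
    moreover have "val_is (2 * j) (fps_cutoff N f)"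
      using that(1) by (rule val_is_eqX[of _ _ N]) (use j in \<open>auto simp: N_p eqX_sym\<close>)
    ultimately show ?thesis by (simp add: first_components_def)
  qed
  have "card ?W = 2 ^ card ?V"
  proof (rule card_branching)
    obtain d where "val_is (2 * j) d" "eqX (N - 2 * j) d (sig d)" using step[of "2 * j"] by auto
    then show "?W \<noteq> {}" using cut by blast
  next
    fix m w assume m: "m \<in> ?V" and w: "w \<in> ?W"
    have "even m \<or> N - 2 * j \<le> Suc m" "2 * j < m" "m < N" using m j by (auto simp: N_p)
    then obtain d where d: "val_is m d" "eqX (N - 2 * j) d (sig d)" using step by blast
    have "val_is (2 * j) (w + d)"
      using w d(1) \<open>2 * j < m\<close> by (auto simp: first_components_def val_is_def eqX_def)
    moreover have "eqX (N - 2 * j) (w + d) (sig (w + d))"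
      unfolding sig_add using w d(2) by (intro eqX_add) (auto simp: first_components_def)
    ultimately have "fps_cutoff N (w + d) \<in> ?W" by (rule cut)
    moreover have "eqX m w (fps_cutoff N (w + d))" "w $ m \<noteq> fps_cutoff N (w + d) $ m"
      using d(1) \<open>m < N\<close> by (auto simp: val_is_def eqX_def)
    ultimately show "\<exists>w'\<in>?W. eqX m w w' \<and> w $ m \<noteq> w' $ m" by blast
  next
    fix m w w' assume m: "m < N" "m \<notin> ?V" and w: "w \<in> ?W" "w' \<in> ?W" "eqX m w w'"
    show "w $ m = w' $ m"
    proof (rule ccontr)
      assume neq: "w $ m \<noteq> w' $ m"
      then have d: "val_is m (w + w')" using w by (simp add: val_is_add_iff)
      have "2 * j < m"
      proof (rule ccontr)
        assume "\<not> 2 * j < m"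
        then show False using w neq by (cases "m = 2 * j") (auto simp: first_components_def val_is_def eqX_def)
      qed
      have "eqX (N - 2 * j) (w + w') (sig (w + w'))"
        unfolding sig_add using w by (intro eqX_add) (auto simp: first_components_def)
      then have "even m \<or> N - 2 * j \<le> Suc m" using symmetric_val[OF _ d] by blast
      then show False
      proof
        assume "even m"
        then obtain i where "m = 2 * i" by (elim evenE)
        then have "m \<in> ?V" using m(1) \<open>2 * j < m\<close>
          by (cases "i < 2 * p - j") (auto simp: N_p)
        then show False using m by simp
      next
        assume "N - 2 * j \<le> Suc m"
        then have "m \<in> ?V" using m(1) by (auto simp: N_p)
        then show False using m by simp
      qed
    qed
  next
    show "?W \<subseteq> trunc_set N" by (auto simp: first_components_def)
    show "?V \<subseteq> {..<N}" using j by (auto simp: N_p)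
  qed
  also have "card ?V = card ((\<lambda>i. 2 * i) ` {Suc j..<2 * p - j}) + card {4 * p - 2 * j - 1..<4 * p}"
    by (rule card_Un_disjoint) auto
  also have "\<dots> = 2 * p"
    using j by (subst card_image) (auto simp: inj_on_def)
  finally show ?thesis .
qed

lemma kernel_levels_iff:
  assumes "4 \<le> M" "even M" "M \<le> N"
  shows "m \<in> kernel_levels M \<longleftrightarrow>
    (m = 1 \<and> (M < N \<or> e = N - 1)) \<or> (0 < m \<and> even m) \<or> M \<le> Suc m"
proof
  assume "m \<in> kernel_levels M"
  then obtain \<rho> where \<rho>: "0 < m" "val_is m (\<rho> + 1)" "eqX M (norm \<rho>) 1"
    by (auto simp: kernel_levels_def)
  show "(m = 1 \<and> (M < N \<or> e = N - 1)) \<or> (0 < m \<and> even m) \<or> M \<le> Suc m"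
  proof (rule ccontr)
    assume *: "\<not> ?thesis"
    then have "odd m" "Suc m < M" using \<rho> by auto
    then have "m = 1" using kernel_odd[OF \<rho>(2) _ _ _] \<rho>(3) by (cases "3 \<le> m") (auto, presburger)
    with * have "M = N" "e = 2 * p - 1" using e_cases assms by auto
    then have "\<rho> $ 1 = 0" using kernel_not_one \<rho>(3) by blast
    then show False using \<rho>(2) \<open>m = 1\<close> by (simp add: val_is_def)
  qed
next
  assume "(m = 1 \<and> (M < N \<or> e = N - 1)) \<or> (0 < m \<and> even m) \<or> M \<le> Suc m"
  then consider "m = 1" "M < N \<or> M = N \<and> e = N - 1" | "2 \<le> m" "even m" | "M \<le> Suc m"
    using assms(3) by fastforce
  then show "m \<in> kernel_levels M"
  proof cases
    case 1
    then show ?thesis using kernel_one[of M] by (auto simp: kernel_levels_def)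
  next
    case 2
    then show ?thesis using kernel_even[of m] eqX_mono assms by (auto simp: kernel_levels_def)
  next
    case 3
    then show ?thesis using kernel_high[of M m] assms by (auto simp: kernel_levels_def)
  qed
qed

lemma card_kernel_levels:
  assumes j: "j < p"
  shows "card {m \<in> kernel_levels (N - 2 * (2 * j)). m < N - 2 * j}
    = 2 * p + (if j = 0 \<and> e \<noteq> N - 1 then 0 else 1)"
proof -
  let ?V = "(\<lambda>i. 2 * i) ` {1..<2 * p - 2 * j} \<union> {4 * p - 4 * j - 1..<4 * p - 2 * j}"
  let ?one = "\<lambda>b. if b then {} else {1::nat}"
  have M: "4 \<le> N - 2 * (2 * j)" "even (N - 2 * (2 * j))" "N - 2 * (2 * j) \<le> N"
    using j by (auto simp: N_p)
  have lt: "N - 2 * (2 * j) < N \<longleftrightarrow> j \<noteq> 0" using p_pos by (auto simp: N_p)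
  have "{m \<in> kernel_levels (N - 2 * (2 * j)). m < N - 2 * j} = ?one (j = 0 \<and> e \<noteq> N - 1) \<union> ?V"
  proof (intro Set.set_eqI iffI)
    fix m assume "m \<in> {m \<in> kernel_levels (N - 2 * (2 * j)). m < N - 2 * j}"
    then have m: "(m = 1 \<and> (j \<noteq> 0 \<or> e = N - 1)) \<or> (0 < m \<and> even m) \<or> N - 2 * (2 * j) \<le> Suc m"
      "m < N - 2 * j"
      using kernel_levels_iff[OF M] lt by auto
    then consider "m = 1" "j \<noteq> 0 \<or> e = N - 1" | "0 < m" "even m" "Suc m < N - 2 * (2 * j)"
      | "N - 2 * (2 * j) \<le> Suc m" by linarith
    then show "m \<in> ?one (j = 0 \<and> e \<noteq> N - 1) \<union> ?V"
    proof cases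
      case 2
      then obtain i where "m = 2 * i" by blast
      then show ?thesis using 2 by (auto simp: N_p)
    qed (use m in \<open>auto simp: N_p\<close>)
  next
    fix m assume "m \<in> ?one (j = 0 \<and> e \<noteq> N - 1) \<union> ?V"
    then show "m \<in> {m \<in> kernel_levels (N - 2 * (2 * j)). m < N - 2 * j}"
      using j p_pos unfolding mem_Collect_eq kernel_levels_iff[OF M] lt
      by (auto simp: N_p split: if_splits)
  qed
  moreover have "card ?V = card ((\<lambda>i. 2 * i) ` {1..<2 * p - 2 * j}) + card {4 * p - 4 * j - 1..<4 * p - 2 * j}"
    by (rule card_Un_disjoint) auto
  then have "card ?V = 2 * p"
    using j by (subst (asm) card_image) (auto simp: inj_on_def)
  moreover have "1 \<notin> ?V" "finite ?V" using j by auto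
  ultimately show ?thesis by auto
qed

text \<open>The number of \<open>v\<close> that belong to a given unit \<open>y\<close>. It is the only quantity in which the three
families differ: the quaternion group has no solution at all, and the semidihedral group
lacks the kernel level \<open>1\<close>.\<close>

definition unit_fibre :: nat where
  "unit_fibre = (if c \<noteq> 0 then 0 else if e = N - 1 then 2 ^ (2 * p + 1) else 2 ^ (2 * p))"

lemma card_second_components_even:
  assumes j: "j < p" and y: "y \<in> first_components (2 * j)"
  shows "card {v \<in> trunc_set N. sol y v} = (if j = 0 then unit_fibre else 2 ^ (2 * p + 1))"
proof -
  have y': "val_is (2 * j) y" "eqX (N - 2 * j) y (sig y)" using y by (auto simp: first_components_def)
  have k: "2 * j < 2 * p" using j by simp
  show ?thesis
  proof (cases "j = 0 \<and> c \<noteq> 0")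
    case True
    then have "c = 2 * p" "e = N - 1" using c_cases by auto
    then have "\<not> sol y v" for v
      unfolding sol_iff[OF y'(1) k] using not_norm True by auto
    then show ?thesis using True by (simp add: unit_fibre_def)
  next
    case False
    have "\<exists>q. q $ 0 = 1 \<and> eqX (N - 2 * (2 * j)) (norm q) (gen_a ^ c)"
      by (rule norm_exists) (use False j p_pos in \<open>auto simp: N_p\<close>)
    then have "\<exists>v. sol y v" unfolding sol_iff[OF y'(1) k] using y' by blast
    then obtain v where "sol y v" ..
    from card_second_components[OF y'(1) k this] show ?thesis
      unfolding card_kernel_levels[OF j] using False by (auto simp: unit_fibre_def)
  qed
qed

text \<open>The pairs in which \<open>y\<close>, and hence \<open>v\<close>, vanishes to order at least \<open>N/2\<close> contribute \<open>2^N\<close>; each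
of the \<open>p - 1\<close> even orders strictly between \<open>0\<close> and \<open>N/2 = 2 p\<close> contributes
\<open>2^(2 p) * 2^(2 p + 1) = 2^(N + 1)\<close>; odd orders contribute nothing.\<close>

lemma card_solutions:
  "card {(y, v). y \<in> trunc_set N \<and> v \<in> trunc_set N \<and> sol y v}
    = 2 ^ N + 2 ^ (2 * p) * unit_fibre + (p - 1) * 2 ^ (N + 1)"
proof -
  let ?T = "trunc_set N"
  define S where "S k = (SIGMA y:first_components k. {v \<in> ?T. sol y v})" for k
  define S' where "S' = {y \<in> ?T. eqX (2 * p) y 0} \<times> {v \<in> ?T. eqX (2 * p) v 0}"
  have fin: "finite (S k)" "finite S'" for k
    using finite_trunc_set[of N] by (auto simp: S_def S'_def first_components_def)
  have in_S: "(y, v) \<in> S k \<longleftrightarrow> y \<in> ?T \<and> val_is k y \<and> v \<in> ?T \<and> sol y v" if "k < 2 * p" for y v k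
    using sol_iff[OF _ that, of y v] by (auto simp: S_def first_components_def)
  have in_S': "(y, v) \<in> S' \<longleftrightarrow> y \<in> ?T \<and> eqX (2 * p) y 0 \<and> v \<in> ?T \<and> sol y v" for y v
    using sol_high[of y v] by (auto simp: S'_def)
  have split: "eqX (2 * p) y 0 \<longleftrightarrow> \<not> (\<exists>k<2 * p. val_is k y)" for y
    using ex_val[of "2 * p" y] not_eqX_val[of _ y "2 * p"] by (meson leD)
  have eq: "{(y, v). y \<in> ?T \<and> v \<in> ?T \<and> sol y v} = S' \<union> (\<Union>k<2 * p. S k)"
    by (intro Set.set_eqI, clarify) (auto simp: in_S in_S' split)
  have disj: "S' \<inter> (\<Union>k<2 * p. S k) = {}"
    by (auto simp: in_S in_S' split)
  have card_S: "card (S k) = (\<Sum>y\<in>first_components k. card {v \<in> ?T. sol y v})" for k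
    unfolding S_def using finite_trunc_set[of N] by (intro card_SigmaI) (auto simp: first_components_def)
  have "card (\<Union>k<2 * p. S k) = (\<Sum>k<2 * p. card (S k))"
    using fin by (intro card_UN_disjoint) (auto simp: in_S dest: val_is_unique)
  also have "\<dots> = (\<Sum>k\<in>(\<lambda>j. 2 * j) ` {..<p}. card (S k))"
  proof (rule sum.mono_neutral_right)
    show "\<forall>k\<in>{..<2 * p} - (\<lambda>j. 2 * j) ` {..<p}. card (S k) = 0"
    proof
      fix k assume k: "k \<in> {..<2 * p} - (\<lambda>j. 2 * j) ` {..<p}"
      then have "odd k" by (auto elim!: evenE)
      then show "card (S k) = 0" using k first_components_odd[of k] by (simp add: S_def)
    qed
  qed auto
  also have "\<dots> = (\<Sum>j<p. card (S (2 * j)))"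
    by (subst sum.reindex) (auto simp: inj_on_def)
  also have "\<dots> = (\<Sum>j<p. 2 ^ (2 * p) * (if j = 0 then unit_fibre else 2 ^ (2 * p + 1)))"
    by (intro sum.cong) (simp_all add: card_S card_second_components_even card_first_components)
  also have "\<dots> = 2 ^ (2 * p) * unit_fibre + (p - 1) * 2 ^ (N + 1)"
  proof -
    obtain x where x: "p = Suc x" using p_pos by (cases p) auto
    have "(2::nat) ^ (N + 1) = 2 ^ (2 * p) * 2 ^ (2 * p + 1)" by (simp add: N_p flip: power_add)
    then show ?thesis unfolding x sum.lessThan_Suc_shift by simp
  qed
  finally have "card (\<Union>k<2 * p. S k) = 2 ^ (2 * p) * unit_fibre + (p - 1) * 2 ^ (N + 1)" .
  moreover have "card S' = 2 ^ N"
  proof -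
    have "N - 2 * p = 2 * p" by (simp add: N_p)
    then have "card S' = 2 ^ (2 * p) * 2 ^ (2 * p)"
      by (simp add: S'_def card_cartesian_product card_trunc_val)
    then show ?thesis by (simp add: N_p flip: power_add)
  qed
  ultimately show ?thesis
    unfolding eq using card_Un_disjoint[OF fin(2) _ disj] fin(1) by simp
qed

end

section \<open>The presented groups\<close>

definition cls :: "('x word \<times> 'x word) set \<Rightarrow> 'x word \<Rightarrow> 'x word set" where
  "cls R w = word_cong R `` {w}"

lemma cls_eq_iff: "cls R u = cls R v \<longleftrightarrow> (u, v) \<in> word_cong R"
  using eq_equiv_class_iff[OF equiv_word_cong] by (simp add: cls_def)

lemma cls_in_carrier: "cls R w \<in> carrier (presented_group R)"
  by (simp add: presented_group_def quotientI cls_def)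

lemma carrier_presented: "carrier (presented_group R) = range (cls R)"
  by (auto simp: presented_group_def quotient_def cls_def)

lemma one_presented: "\<one>\<^bsub>presented_group R\<^esub> = cls R []"
  by (simp add: presented_group_def cls_def)

lemma cls_append: "cls R (u @ v) = cls R u \<otimes>\<^bsub>presented_group R\<^esub> cls R v"
  by (simp add: presented_group_mult_class cls_def)

lemma cls_word_inv: "cls R (word_inv w) = inv\<^bsub>presented_group R\<^esub> cls R w"
proof -
  interpret group "presented_group R" by (rule group_presented_group)
  have "cls R (word_inv w) \<otimes>\<^bsub>presented_group R\<^esub> cls R w = \<one>\<^bsub>presented_group R\<^esub>"
    unfolding cls_append[symmetric] one_presented cls_eq_iff by (rule word_inv_left)
  then show ?thesis using inv_equality cls_in_carrier by metis
qed

lemma cls_replicate: "cls R (concat (replicate k w)) = cls R w [^]\<^bsub>presented_group R\<^esub> k"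
proof -
  interpret group "presented_group R" by (rule group_presented_group)
  show ?thesis
  proof (induction k)
    case 0
    show ?case by (simp only: replicate.simps concat.simps nat_pow_0 one_presented)
  next
    case (Suc k)
    have "cls R (concat (replicate (Suc k) w)) = cls R (w @ concat (replicate k w))" by simp
    also have "\<dots> = cls R w \<otimes>\<^bsub>presented_group R\<^esub> cls R w [^]\<^bsub>presented_group R\<^esub> k"
      unfolding cls_append Suc ..
    also have "\<dots> = cls R w [^]\<^bsub>presented_group R\<^esub> Suc k"
      by (rule nat_pow_Suc2[symmetric, OF cls_in_carrier])
    finally show ?case .
  qed
qed

lemma cls_word_pow: "cls R (word_pow w k) = cls R w [^]\<^bsub>presented_group R\<^esub> k"
proof -
  interpret group "presented_group R" by (rule group_presented_group)
  show ?thesis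
  proof (cases "0 \<le> k")
    case True
    then show ?thesis unfolding word_pow_def int_pow_def2 by (simp only: cls_replicate if_True not_less if_not_P)
  next
    case False
    then have "k < 0" by simp
    with False show ?thesis unfolding word_pow_def int_pow_def2
      by (simp only: cls_replicate cls_word_inv nat_pow_inv[OF cls_in_carrier] if_True if_False)
  qed
qed

text \<open>The presentations prescribe \<open>(a, b) = a^d\<close>, so \<open>b\<inverse> a b = a^(d + 1)\<close>. The assumption makes
this \<open>a^e\<close>, and since \<open>e\<^sup>2 \<equiv> 1\<close> conjugation by \<open>b\<close> and by \<open>b\<inverse>\<close> agree on powers of \<open>a\<close>.\<close>

locale maximal_class_presentation = maximal_class +
  fixes d :: int
  assumes d_mod: "int N dvd d + 1 - int e"
begin

definition rels :: "(generator word \<times> generator word) set" where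
  "rels = {(word_pow wa (2 ^ n), []), (word_pow wb 2, word_pow wa (int c)),
     (word_comm wa wb, word_pow wa d)}"

definition G where "G = presented_group rels"

sublocale G: group G
  unfolding G_def by (rule group_presented_group)

definition A where "A = cls rels wa"
definition B where "B = cls rels wb"

lemma AB_in [simp]: "A \<in> carrier G" "B \<in> carrier G"
  by (simp_all add: A_def B_def G_def cls_in_carrier)

lemma rel_cls: "(u, v) \<in> rels \<Longrightarrow> cls rels u = cls rels v"
  by (simp add: cls_eq_iff word_cong.rel)

lemma A_N: "A [^]\<^bsub>G\<^esub> N = \<one>\<^bsub>G\<^esub>"
proof -
  have "cls rels (word_pow wa (2 ^ n)) = cls rels []"
    by (rule rel_cls) (simp add: rels_def)
  moreover have "(2::int) ^ n = int N" by (simp add: N_eq)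
  ultimately show ?thesis
    by (simp add: cls_word_pow one_presented[symmetric] int_pow_int A_def G_def)
qed

lemma BB: "B \<otimes>\<^bsub>G\<^esub> B = A [^]\<^bsub>G\<^esub> c"
proof -
  have "cls rels (word_pow wb 2) = cls rels (word_pow wa (int c))"
    by (rule rel_cls) (simp add: rels_def)
  moreover have "word_pow wb 2 = wb @ wb" by (simp add: word_pow_def numeral_2_eq_2)
  ultimately show ?thesis
    by (simp add: cls_word_pow cls_append int_pow_int A_def B_def G_def)
qed

lemma comm_rel: "inv\<^bsub>G\<^esub> A \<otimes>\<^bsub>G\<^esub> inv\<^bsub>G\<^esub> B \<otimes>\<^bsub>G\<^esub> A \<otimes>\<^bsub>G\<^esub> B = A [^]\<^bsub>G\<^esub> d"
proof -
  have "cls rels (word_comm wa wb) = cls rels (word_pow wa d)"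
    by (rule rel_cls) (simp add: rels_def)
  then have "inv\<^bsub>G\<^esub> A \<otimes>\<^bsub>G\<^esub> (inv\<^bsub>G\<^esub> B \<otimes>\<^bsub>G\<^esub> (A \<otimes>\<^bsub>G\<^esub> B)) = A [^]\<^bsub>G\<^esub> d"
    by (simp add: word_comm_def cls_word_pow cls_append cls_word_inv A_def B_def G_def)
  then show ?thesis by (simp add: G.m_assoc)
qed

lemma A_pow_mod: "A [^]\<^bsub>G\<^esub> (i mod N) = A [^]\<^bsub>G\<^esub> i"
proof -
  have "A [^]\<^bsub>G\<^esub> i = A [^]\<^bsub>G\<^esub> (N * (i div N) + i mod N)" by simp
  also have "\<dots> = (A [^]\<^bsub>G\<^esub> N) [^]\<^bsub>G\<^esub> (i div N) \<otimes>\<^bsub>G\<^esub> A [^]\<^bsub>G\<^esub> (i mod N)"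
    by (simp only: G.nat_pow_mult[symmetric] G.nat_pow_pow AB_in)
  finally show ?thesis by (simp add: A_N)
qed

lemma A_d: "A \<otimes>\<^bsub>G\<^esub> A [^]\<^bsub>G\<^esub> d = A [^]\<^bsub>G\<^esub> e"
proof -
  obtain t where t: "d + 1 - int e = int N * t" using d_mod by blast
  have "A \<otimes>\<^bsub>G\<^esub> A [^]\<^bsub>G\<^esub> d = A [^]\<^bsub>G\<^esub> (1 + d)"
    by (simp add: G.int_pow_mult G.int_pow_1)
  also have "1 + d = int e + int N * t" using t by simp
  also have "A [^]\<^bsub>G\<^esub> (int e + int N * t) = A [^]\<^bsub>G\<^esub> e \<otimes>\<^bsub>G\<^esub> (A [^]\<^bsub>G\<^esub> int N) [^]\<^bsub>G\<^esub> t"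
    by (simp add: G.int_pow_mult G.int_pow_pow[symmetric] int_pow_int del: G.int_pow_pow)
  finally show ?thesis by (simp add: int_pow_int A_N)
qed

lemma A_B: "A \<otimes>\<^bsub>G\<^esub> B = B \<otimes>\<^bsub>G\<^esub> A [^]\<^bsub>G\<^esub> e"
proof -
  have "B \<otimes>\<^bsub>G\<^esub> A [^]\<^bsub>G\<^esub> e = B \<otimes>\<^bsub>G\<^esub> (A \<otimes>\<^bsub>G\<^esub> (inv\<^bsub>G\<^esub> A \<otimes>\<^bsub>G\<^esub> inv\<^bsub>G\<^esub> B \<otimes>\<^bsub>G\<^esub> A \<otimes>\<^bsub>G\<^esub> B))"
    unfolding comm_rel A_d ..
  also have "\<dots> = A \<otimes>\<^bsub>G\<^esub> B"
    by (simp add: G.m_assoc[symmetric] G.inv_solve_right)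
  finally show ?thesis ..
qed

lemma pow_A_B: "A [^]\<^bsub>G\<^esub> m \<otimes>\<^bsub>G\<^esub> B = B \<otimes>\<^bsub>G\<^esub> A [^]\<^bsub>G\<^esub> (e * m)"
proof (induction m)
  case (Suc m)
  have "A [^]\<^bsub>G\<^esub> Suc m \<otimes>\<^bsub>G\<^esub> B = A [^]\<^bsub>G\<^esub> m \<otimes>\<^bsub>G\<^esub> (A \<otimes>\<^bsub>G\<^esub> B)"
    by (simp add: G.m_assoc)
  also have "\<dots> = (A [^]\<^bsub>G\<^esub> m \<otimes>\<^bsub>G\<^esub> B) \<otimes>\<^bsub>G\<^esub> A [^]\<^bsub>G\<^esub> e"
    unfolding A_B by (simp add: G.m_assoc)
  also have "\<dots> = B \<otimes>\<^bsub>G\<^esub> A [^]\<^bsub>G\<^esub> (e * Suc m)"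
    unfolding Suc by (simp add: G.m_assoc G.nat_pow_mult add.commute)
  finally show ?case .
qed simp

lemma B_pow_A: "B \<otimes>\<^bsub>G\<^esub> A [^]\<^bsub>G\<^esub> m = A [^]\<^bsub>G\<^esub> (e * m) \<otimes>\<^bsub>G\<^esub> B"
proof -
  obtain r where r: "e * e = 1 + N * r" using e_square by blast
  have "e * (e * m) = (1 + N * r) * m" unfolding r[symmetric] by simp
  then have "e * (e * m) = m + N * (r * m)" by (simp add: algebra_simps)
  then have "A [^]\<^bsub>G\<^esub> (e * (e * m)) = A [^]\<^bsub>G\<^esub> m"
    using A_pow_mod[of "e * (e * m)"] A_pow_mod[of m] by simp
  then show ?thesis unfolding pow_A_B by simp
qed

text \<open>The normal form \<open>a^i b^\<beta>\<close>, with \<open>\<beta>\<close> a truth value.\<close>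

definition el :: "nat \<times> bool \<Rightarrow> generator word set" where
  "el x = A [^]\<^bsub>G\<^esub> fst x \<otimes>\<^bsub>G\<^esub> (if snd x then B else \<one>\<^bsub>G\<^esub>)"

definition exp_prod :: "nat \<times> bool \<Rightarrow> nat \<times> bool \<Rightarrow> nat" where
  "exp_prod x y = fst x + (if snd x then e * fst y else fst y) + (if snd x \<and> snd y then c else 0)"

lemma el_in [simp]: "el x \<in> carrier G"
  by (simp add: el_def)

lemma el_mult: "el x \<otimes>\<^bsub>G\<^esub> el y = el (exp_prod x y, snd x \<noteq> snd y)"
proof -
  obtain i \<alpha> j \<beta> where [simp]: "x = (i, \<alpha>)" "y = (j, \<beta>)" by (cases x; cases y) auto
  show ?thesis
  proof (cases \<alpha>)
    case True
    let ?b = "if \<beta> then B else \<one>\<^bsub>G\<^esub>"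
    have b: "?b \<in> carrier G" by simp
    have "el x \<otimes>\<^bsub>G\<^esub> el y = A [^]\<^bsub>G\<^esub> i \<otimes>\<^bsub>G\<^esub> (B \<otimes>\<^bsub>G\<^esub> A [^]\<^bsub>G\<^esub> j) \<otimes>\<^bsub>G\<^esub> ?b"
      using True b by (simp add: el_def G.m_assoc)
    also have "\<dots> = A [^]\<^bsub>G\<^esub> (i + e * j) \<otimes>\<^bsub>G\<^esub> (B \<otimes>\<^bsub>G\<^esub> ?b)"
      unfolding B_pow_A using b by (simp add: G.m_assoc G.nat_pow_mult[symmetric])
    also have "B \<otimes>\<^bsub>G\<^esub> ?b = (if \<beta> then A [^]\<^bsub>G\<^esub> c else B)"
      by (simp add: BB)
    finally show ?thesis using True
      by (simp add: el_def exp_prod_def G.nat_pow_mult)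
  next
    case False
    then show ?thesis
      by (simp add: el_def exp_prod_def G.nat_pow_mult[symmetric] G.m_assoc)
  qed
qed

lemma el_mod: "el (i mod N, \<beta>) = el (i, \<beta>)"
  by (simp add: el_def A_pow_mod)

lemma one_el: "\<one>\<^bsub>G\<^esub> = el (0, False)"
  by (simp add: el_def)

lemma carrier_subset: "carrier G \<subseteq> range el"
proof -
  have mult: "g \<otimes>\<^bsub>G\<^esub> h \<in> range el" if "g \<in> range el" "h \<in> range el" for g h
    using that by (auto simp: el_mult)
  have A: "A \<in> range el" using range_eqI[of A el "(1, False)"] by (simp add: el_def)
  have B: "B \<in> range el" using range_eqI[of B el "(0, True)"] by (simp add: el_def)
  have Ai: "A [^]\<^bsub>G\<^esub> (k::nat) \<in> range el" for k
    using range_eqI[of _ el "(k, False)"] by (simp add: el_def)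
  have iA: "inv\<^bsub>G\<^esub> A = A [^]\<^bsub>G\<^esub> (N - 1)"
  proof (rule G.inv_equality)
    have "A [^]\<^bsub>G\<^esub> (N - 1) \<otimes>\<^bsub>G\<^esub> A = A [^]\<^bsub>G\<^esub> (Suc (N - 1))" by simp
    then show "A [^]\<^bsub>G\<^esub> (N - 1) \<otimes>\<^bsub>G\<^esub> A = \<one>\<^bsub>G\<^esub>" using N_p p_pos A_N by simp
  qed auto
  have iB: "inv\<^bsub>G\<^esub> B = A [^]\<^bsub>G\<^esub> (N - c) \<otimes>\<^bsub>G\<^esub> B"
  proof (rule G.inv_equality)
    have "c \<le> N" using c_cases N_p by auto
    then show "A [^]\<^bsub>G\<^esub> (N - c) \<otimes>\<^bsub>G\<^esub> B \<otimes>\<^bsub>G\<^esub> B = \<one>\<^bsub>G\<^esub>"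
      by (simp add: G.m_assoc BB G.nat_pow_mult A_N)
  qed auto
  have letter: "cls rels [l] \<in> range el" for l
  proof -
    obtain x s where l: "l = (x, s)" by (cases l)
    have inv: "cls rels [(y, False)] = inv\<^bsub>G\<^esub> cls rels (gen y)" for y
      using cls_word_inv[of rels "gen y"] by (simp add: word_inv_def gen_def G_def)
    have "cls rels [(GenA, True)] = A" "cls rels [(GenB, True)] = B"
      by (simp_all add: A_def B_def gen_def)
    moreover have "inv\<^bsub>G\<^esub> A \<in> range el" "inv\<^bsub>G\<^esub> B \<in> range el"
      unfolding iA iB by (intro Ai mult B)+
    ultimately show ?thesis using A B inv[of GenA] inv[of GenB]
      by (cases x; cases s) (simp_all add: l A_def B_def)
  qed
  have "cls rels w \<in> range el" for w
  proof (induction w)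
    case Nil
    show ?case using Ai[of 0] by (simp add: G_def one_presented)
  next
    case (Cons l w)
    have "cls rels (l # w) = cls rels [l] \<otimes>\<^bsub>G\<^esub> cls rels w"
      using cls_append[of rels "[l]" w] by (simp add: G_def)
    then show ?case using mult letter Cons by simp
  qed
  then show ?thesis by (auto simp: G_def carrier_presented)
qed

text \<open>That the normal forms are pairwise distinct is shown by letting words act on their indices as
left multiplication would, with the exponent of \<open>a\<close> understood modulo \<open>N\<close>. Integer exponents
are used since a letter may be an inverse.\<close>

fun step :: "generator \<times> bool \<Rightarrow> int \<times> bool \<Rightarrow> int \<times> bool" where
  "step (GenA, True) (i, \<beta>) = (i + 1, \<beta>)"
| "step (GenA, False) (i, \<beta>) = (i - 1, \<beta>)"
| "step (GenB, True) (i, \<beta>) = (int e * i + (if \<beta> then int c else 0), \<not> \<beta>)"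
| "step (GenB, False) (i, \<beta>) = (int e * (i - (if \<beta> then 0 else int c)), \<not> \<beta>)"

definition act :: "generator word \<Rightarrow> int \<times> bool \<Rightarrow> int \<times> bool" where
  "act w = foldr step w"

definition same :: "int \<times> bool \<Rightarrow> int \<times> bool \<Rightarrow> bool" where
  "same x y \<longleftrightarrow> int N dvd fst x - fst y \<and> snd x = snd y"

lemma same_refl: "same x x" and same_sym: "same x y \<Longrightarrow> same y x"
  by (auto simp: same_def dvd_diff_commute)

lemma same_trans: "same x y \<Longrightarrow> same y z \<Longrightarrow> same x z"
  unfolding same_def using dvd_add[of "int N" "fst x - fst y" "fst y - fst z"] by auto

lemma e_square_int: "int N dvd int e * int e - 1"
proof -
  obtain r where "e * e = 1 + N * r" using e_square by blast
  then have "int e * int e = 1 + int N * int r" by (metis of_nat_1 of_nat_add of_nat_mult)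
  then show ?thesis by simp
qed

lemma e_c_int: "int N dvd int e * int c - int c"
proof -
  obtain k where k: "e = 2 * k + 1" using e_odd by (elim oddE)
  have "c = 0 \<or> 2 * c = N" using c_cases N_p by auto
  then have "int e * int c - int c = 0 \<or> int e * int c - int c = int N * int k"
    by (auto simp: k algebra_simps)
  then show ?thesis by auto
qed

lemma step_same: "same x y \<Longrightarrow> same (step l x) (step l y)"
proof -
  assume s: "same x y"
  obtain g t i \<alpha> j \<beta> where [simp]: "l = (g, t)" "x = (i, \<alpha>)" "y = (j, \<beta>)"
    by (cases l; cases x; cases y) auto
  have [simp]: "\<alpha> = \<beta>" and ij: "int N dvd i - j" using s by (auto simp: same_def)
  have "int N dvd int e * (i - j)" using ij by simp
  then show ?thesis using ij
    by (cases g; cases t) (auto simp: same_def algebra_simps)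
qed

lemma act_append: "act (u @ v) s = act u (act v s)"
  by (simp add: act_def)

lemma act_same: "same x y \<Longrightarrow> same (act w x) (act w y)"
  by (induction w) (auto simp: act_def step_same)

lemma act_pow_a: "act (word_pow wa k) (i, \<beta>) = (i + k, \<beta>)"
proof -
  have "act (concat (replicate m [(GenA, True)])) (i, \<beta>) = (i + int m, \<beta>)"
       "act (concat (replicate m [(GenA, False)])) (i, \<beta>) = (i - int m, \<beta>)" for m
    by (induction m) (auto simp: act_def)
  then show ?thesis by (simp add: word_pow_def gen_def word_inv_def)
qed

lemma act_rels:
  assumes "(u, v) \<in> rels"
  shows "same (act u s) (act v s)"
proof -
  obtain i \<beta> where s: "s = (i, \<beta>)" by (cases s)
  have ee: "int N dvd int e * (int e * i) - i"
  proof -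
    have "int e * (int e * i) - i = (int e * int e - 1) * i" by (simp add: algebra_simps)
    then show ?thesis using e_square_int by simp
  qed
  consider "u = word_pow wa (2 ^ n)" "v = []" | "u = word_pow wb 2" "v = word_pow wa (int c)"
    | "u = word_comm wa wb" "v = word_pow wa d"
    using assms by (auto simp: rels_def)
  then show ?thesis
  proof cases
    case 1
    have "int N dvd 2 ^ n" by (simp add: N_eq)
    then show ?thesis unfolding 1 s act_pow_a by (simp add: act_def same_def)
  next
    case 2
    have "act (word_pow wb 2) s = (int e * (int e * i + (if \<beta> then int c else 0)) + (if \<beta> then 0 else int c), \<beta>)"
      by (simp add: s word_pow_def gen_def numeral_2_eq_2 act_def)
    moreover have "int N dvd (int e * (int e * i) - i) + (int e * int c - int c)"
      using ee e_c_int by (rule dvd_add)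
    ultimately show ?thesis using ee unfolding 2 s act_pow_a
      by (simp add: same_def algebra_simps)
  next
    case 3
    have "act (word_comm wa wb) s = (int e * (int e * i + 1) - 1, \<beta>)"
      by (simp add: s word_comm_def gen_def word_inv_def act_def algebra_simps)
    moreover have "int N dvd (int e * (int e * i) - i) - (d + 1 - int e)"
      using ee d_mod by (rule dvd_diff)
    ultimately show ?thesis unfolding 3 s act_pow_a
      by (simp add: same_def algebra_simps)
  qed
qed

text \<open>Well-definedness of the regular action on the presented group. The instance at the identity
\<open>(0, False)\<close> recovers the normal form of a word from its class.\<close>

lemma act_cong: "(u, v) \<in> word_cong rels \<Longrightarrow> same (act u s) (act v s)"
proof (induction arbitrary: s rule: word_cong.induct)
  case (rel u v)
  then show ?case by (rule act_rels)
next
  case (cancel x t)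
  obtain i \<beta> where s: "s = (i, \<beta>)" by (cases s)
  have ee: "int N dvd int e * (int e * j) - j" for j
  proof -
    have "int e * (int e * j) - j = (int e * int e - 1) * j" by (simp add: algebra_simps)
    then show ?thesis using e_square_int by simp
  qed
  show ?case
    using ee[of i] ee[of "i - int c"]
    by (cases x; cases t; cases \<beta>) (auto simp: s act_def same_def algebra_simps)
next
  case (append u u' v v')
  show ?case unfolding act_append
    using same_trans[OF act_same[OF append.IH(2)] append.IH(1)] .
qed (blast intro: same_refl same_sym same_trans)+

lemma el_inj: "inj_on el ({..<N} \<times> UNIV)"
proof (rule inj_onI)
  fix x y assume x: "x \<in> {..<N} \<times> (UNIV::bool set)" and y: "y \<in> {..<N} \<times> (UNIV::bool set)" and eq: "el x = el y"
  let ?w = "\<lambda>x::nat \<times> bool. word_pow wa (int (fst x)) @ (if snd x then wb else [])"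
  have el: "el x = cls rels (?w x)" for x
    by (simp add: el_def cls_append cls_word_pow int_pow_int A_def B_def G_def one_presented[symmetric])
  have act: "act (?w x) (0, False) = (int (fst x), snd x)" for x
    unfolding act_append by (auto simp: act_pow_a act_def gen_def) (simp_all add: act_def[symmetric] act_pow_a gen_def[symmetric])
  have "(?w x, ?w y) \<in> word_cong rels" using eq unfolding el cls_eq_iff .
  from act_cong[OF this, of "(0, False)"] have s: "int N dvd int (fst x) - int (fst y)" "snd x = snd y"
    unfolding act by (auto simp: same_def)
  then have "int (fst x) mod int N = int (fst y) mod int N" by (simp add: mod_eq_dvd_iff)
  then have "fst x = fst y" using x y by (auto simp flip: of_nat_mod)
  then show "x = y" using s(2) by (simp add: prod_eq_iff)
qed

lemma el_bij: "bij_betw el ({..<N} \<times> UNIV) (carrier G)"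
proof -
  have "carrier G \<subseteq> el ` ({..<N} \<times> UNIV)"
  proof
    fix g assume "g \<in> carrier G"
    then obtain i \<beta> where "g = el (i, \<beta>)" using carrier_subset by auto
    then have "g = el (i mod N, \<beta>)" by (simp add: el_mod)
    moreover have "i mod N < N" using N_p p_pos by simp
    ultimately show "g \<in> el ` ({..<N} \<times> UNIV)" by blast
  qed
  then show ?thesis using el_inj by (auto simp: bij_betw_def)
qed

section \<open>Squares in the group algebra\<close>

abbreviation I where "I \<equiv> {..<N} \<times> (UNIV :: bool set)"

abbreviation GA where "GA \<equiv> (group_algebra G :: (_ \<Rightarrow> bit) ring)"

text \<open>For an element \<open>u + v b\<close> of the group algebra, \<open>coeffs\<close> and \<open>part\<close> give \<open>u\<close> (for \<open>False\<close>) and \<open>v\<close>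
(for \<open>True\<close>): the former lists the coordinates with respect to the powers of \<open>a\<close>, the latter is
the power series in \<open>X = a + 1\<close>.\<close>

definition coeffs :: "bool \<Rightarrow> (generator word set \<Rightarrow> bit) \<Rightarrow> bit fps" where
  "coeffs \<beta> x = Abs_fps (\<lambda>i. if i < N then x (el (i, \<beta>)) else 0)"

definition part :: "bool \<Rightarrow> (generator word set \<Rightarrow> bit) \<Rightarrow> bit fps" where
  "part \<beta> x = a_poly N (coeffs \<beta> x)"

lemma part_eq: "part \<beta> x = (\<Sum>i<N. fps_const (x (el (i, \<beta>))) * gen_a ^ i)"
  by (simp add: part_def coeffs_def a_poly_def)

lemma coeffs_in: "coeffs \<beta> x \<in> trunc_set N"
  by (simp add: trunc_set_def coeffs_def)

lemma cutoff_id: "f \<in> trunc_set N \<Longrightarrow> fps_cutoff N f = f"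
  by (auto simp: trunc_set_def fps_eq_iff)

lemma coeffs_part: "a_poly N (part \<beta> x) = coeffs \<beta> x"
  by (simp add: part_def a_poly_a_poly cutoff_id coeffs_in)

lemma parts_inj:
  assumes "x \<in> carrier GA" "y \<in> carrier GA" "\<And>\<beta>. part \<beta> x = part \<beta> y"
  shows "x = y"
proof
  fix g
  show "x g = y g"
  proof (cases "g \<in> carrier G")
    case True
    then have "g \<in> el ` I" using el_bij by (simp add: bij_betw_def)
    then obtain i \<beta> where g: "g = el (i, \<beta>)" "i < N" by blast
    have "coeffs \<beta> x $ i = coeffs \<beta> y $ i" using assms(3)[of \<beta>] coeffs_part by metis
    then show ?thesis using g by (simp add: coeffs_def)
  next
    case False
    then show ?thesis using assms(1,2) by (simp add: group_algebra_def)
  qed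
qed

lemma parts_surj:
  assumes "f \<in> trunc_set N" "g \<in> trunc_set N"
  obtains x where "x \<in> carrier GA" "part False x = f" "part True x = g"
proof
  let ?f = "a_poly N f" and ?g = "a_poly N g"
  define x where "x h = (if h \<in> carrier G
    then let (i, \<beta>) = the_inv_into I el h in (if \<beta> then ?g else ?f) $ i else 0)" for h
  show "x \<in> carrier GA" by (simp add: group_algebra_def x_def)
  have "x (el (i, \<beta>)) = (if \<beta> then ?g else ?f) $ i" if "i < N" for i \<beta>
    using that by (simp add: x_def the_inv_into_f_f[OF el_inj])
  then have "coeffs \<beta> x = (if \<beta> then ?g else ?f)" for \<beta>
    using a_poly_in[of N f] a_poly_in[of N g]
    by (auto simp: fps_eq_iff coeffs_def trunc_set_def simp del: a_poly_in)
  then show "part False x = f" "part True x = g"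
    using assms by (simp_all add: part_def a_poly_a_poly cutoff_id)
qed

lemma in_GA: "x \<in> carrier GA \<longleftrightarrow> (\<forall>g. g \<notin> carrier G \<longrightarrow> x g = 0)"
  by (simp add: group_algebra_def)

lemma mult_GA: "(x \<otimes>\<^bsub>GA\<^esub> y) g = (\<Sum>(h, k)\<in>{(h, k) \<in> carrier G \<times> carrier G. h \<otimes>\<^bsub>G\<^esub> k = g}. x h * y k)"
  by (simp add: group_algebra_def)

lemma mult_in: "x \<otimes>\<^bsub>GA\<^esub> y \<in> carrier GA"
  unfolding in_GA mult_GA
proof (intro allI impI)
  fix g assume "g \<notin> carrier G"
  then have "{(h, k) \<in> carrier G \<times> carrier G. h \<otimes>\<^bsub>G\<^esub> k = g} = {}" by auto
  then show "(\<Sum>(h, k)\<in>{(h, k) \<in> carrier G \<times> carrier G. h \<otimes>\<^bsub>G\<^esub> k = g}. x h * y k) = 0"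
    by (simp only: sum.empty)
qed

lemma one_in: "\<one>\<^bsub>GA\<^esub> \<in> carrier GA"
  by (auto simp: group_algebra_def)

lemma el_eq_iff: "i < N \<Longrightarrow> j < N \<Longrightarrow> el (i, \<alpha>) = el (j, \<beta>) \<longleftrightarrow> i = j \<and> \<alpha> = \<beta>"
  using el_inj by (auto simp: inj_on_def)

lemma mult_at_el:
  assumes "k < N"
  shows "(x \<otimes>\<^bsub>GA\<^esub> y) (el (k, \<gamma>)) =
    (\<Sum>(r, s)\<in>I \<times> I. if exp_prod r s mod N = k \<and> (snd r \<noteq> snd s) = \<gamma> then x (el r) * y (el s) else 0)"
proof -
  let ?C = "carrier G \<times> carrier G"
  let ?F = "\<lambda>q. if fst q \<otimes>\<^bsub>G\<^esub> snd q = el (k, \<gamma>) then x (fst q) * y (snd q) else 0"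
  have fin: "finite ?C"
    using bij_betw_finite[OF el_bij] by simp
  have N: "0 < N" using N_p p_pos by simp
  have P: "{(h, l) \<in> ?C. h \<otimes>\<^bsub>G\<^esub> l = el (k, \<gamma>)} = {q \<in> ?C. fst q \<otimes>\<^bsub>G\<^esub> snd q = el (k, \<gamma>)}"
    by (simp only: case_prod_unfold prod.collapse)
  have "(x \<otimes>\<^bsub>GA\<^esub> y) (el (k, \<gamma>)) = (\<Sum>q\<in>{q \<in> ?C. fst q \<otimes>\<^bsub>G\<^esub> snd q = el (k, \<gamma>)}. x (fst q) * y (snd q))"
    unfolding mult_GA P by (simp only: case_prod_unfold)
  also have "\<dots> = sum ?F ?C"
    by (rule sum.inter_filter[OF fin])
  also have "\<dots> = (\<Sum>q\<in>I \<times> I. ?F (map_prod el el q))"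
    by (rule sum.reindex_bij_betw[OF bij_betw_map_prod[OF el_bij el_bij], symmetric])
  also have "\<dots> = (\<Sum>(r, s)\<in>I \<times> I. if exp_prod r s mod N = k \<and> (snd r \<noteq> snd s) = \<gamma> then x (el r) * y (el s) else 0)"
  proof (intro sum.cong HOL.refl)
    fix q :: "(nat \<times> bool) \<times> (nat \<times> bool)"
    obtain r s where q: "q = (r, s)" by (cases q)
    have "el r \<otimes>\<^bsub>G\<^esub> el s = el (exp_prod r s mod N, snd r \<noteq> snd s)"
      by (simp only: el_mult el_mod)
    moreover have "exp_prod r s mod N < N" using N by simp
    ultimately have "el r \<otimes>\<^bsub>G\<^esub> el s = el (k, \<gamma>) \<longleftrightarrow> exp_prod r s mod N = k \<and> (snd r \<noteq> snd s) = \<gamma>"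
      using assms by (simp only: el_eq_iff)
    then show "?F (map_prod el el q) = (case q of (r, s) \<Rightarrow>
      if exp_prod r s mod N = k \<and> (snd r \<noteq> snd s) = \<gamma> then x (el r) * y (el s) else 0)"
      by (simp only: q map_prod_simp fst_conv snd_conv prod.case)
  qed
  finally show ?thesis .
qed

text \<open>The product of normal forms is only known with an exponent that may exceed \<open>N\<close>. Its reduction
does not matter modulo \<open>X^N\<close>, because \<open>a^N \<equiv> 1\<close>.\<close>

lemma part_mult_sum:
  "eqX N (part \<gamma> (x \<otimes>\<^bsub>GA\<^esub> y))
     (\<Sum>(r, s)\<in>I \<times> I. if (snd r \<noteq> snd s) = \<gamma>
        then fps_const (x (el r)) * fps_const (y (el s)) * gen_a ^ exp_prod r s else 0)"
proof -
  let ?t = "\<lambda>r s. fps_const (x (el r)) * fps_const (y (el s))"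
  have N: "0 < N" using N_p p_pos by simp
  have "part \<gamma> (x \<otimes>\<^bsub>GA\<^esub> y) = (\<Sum>k<N. \<Sum>(r, s)\<in>I \<times> I.
      if exp_prod r s mod N = k \<and> (snd r \<noteq> snd s) = \<gamma> then ?t r s * gen_a ^ k else 0)"
  proof -
    have sum_const: "fps_const (sum h J) = (\<Sum>j\<in>J. fps_const (h j))" for h :: "_ \<Rightarrow> bit" and J
      by (induction J rule: infinite_finite_induct) (simp_all add: fps_const_add[symmetric] del: fps_const_add)
    show ?thesis
      unfolding part_eq
      by (intro sum.cong HOL.refl) (auto simp: mult_at_el sum_const sum_distrib_right intro!: sum.cong)
  qed
  also have "\<dots> = (\<Sum>(r, s)\<in>I \<times> I. \<Sum>k<N.
      if exp_prod r s mod N = k \<and> (snd r \<noteq> snd s) = \<gamma> then ?t r s * gen_a ^ k else 0)"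
    by (subst sum.swap) (simp add: case_prod_unfold)
  also have "\<dots> = (\<Sum>(r, s)\<in>I \<times> I. if (snd r \<noteq> snd s) = \<gamma> then ?t r s * gen_a ^ (exp_prod r s mod N) else 0)"
  proof (rule sum.cong[OF HOL.refl])
    fix q :: "(nat \<times> bool) \<times> (nat \<times> bool)"
    obtain r s where q: "q = (r, s)" by (cases q)
    have "exp_prod r s mod N < N" using N by simp
    then have "(\<Sum>k<N. if exp_prod r s mod N = k \<and> (snd r \<noteq> snd s) = \<gamma> then ?t r s * gen_a ^ k else 0) =
      (if (snd r \<noteq> snd s) = \<gamma> then ?t r s * gen_a ^ (exp_prod r s mod N) else 0)"
      by (cases "(snd r \<noteq> snd s) = \<gamma>") simp_all
    then show "(case q of (r, s) \<Rightarrow> \<Sum>k<N. if exp_prod r s mod N = k \<and> (snd r \<noteq> snd s) = \<gamma> then ?t r s * gen_a ^ k else 0) =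
      (case q of (r, s) \<Rightarrow> if (snd r \<noteq> snd s) = \<gamma> then ?t r s * gen_a ^ (exp_prod r s mod N) else 0)"
      by (simp only: q prod.case)
  qed
  finally have eq: "part \<gamma> (x \<otimes>\<^bsub>GA\<^esub> y) = \<dots>" .
  show ?thesis unfolding eq case_prod_unfold
    using eqX_mult[OF eqX_refl eqX_sym[OF gen_a_mod]] by (intro eqX_sum) simp
qed

lemma sum_I: "sum k I = (\<Sum>i<N. k (i, False)) + (\<Sum>i<N. k (i, True))"
proof -
  have "sum k I = (\<Sum>i<N. \<Sum>\<beta>\<in>UNIV. k (i, \<beta>))"
    by (simp only: sum.cartesian_product case_prod_unfold prod.collapse)
  then show ?thesis by (simp add: UNIV_bool sum.distrib)
qed

lemma sum_pairs:
  fixes h :: "nat \<times> bool \<Rightarrow> nat \<times> bool \<Rightarrow> bit fps"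
  shows "(\<Sum>(r, s)\<in>I \<times> I. if (snd r \<noteq> snd s) = \<gamma> then h r s else 0)
    = (\<Sum>i<N. \<Sum>j<N. h (i, False) (j, \<gamma>)) + (\<Sum>i<N. \<Sum>j<N. h (i, True) (j, \<not> \<gamma>))"
proof -
  show ?thesis
    unfolding sum.cartesian_product[symmetric] sum_I
    by (cases \<gamma>) (simp_all add: sum.distrib)
qed

lemma sig_part: "sig (part \<beta> x) = (\<Sum>i<N. fps_const (x (el (i, \<beta>))) * gen_a ^ (e * i))"
proof -
  have sig_sum: "sig (sum f J) = (\<Sum>j\<in>J. sig (f j))" for f :: "nat \<Rightarrow> bit fps" and J
    by (induction J rule: infinite_finite_induct) (simp_all add: sig_add)
  have sig_const: "sig (fps_const b) = fps_const b" for b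
    by (simp add: sig_def)
  show ?thesis unfolding part_eq by (simp only: sig_sum sig_mult sig_const sig_gen_a_pow)
qed

lemma part_times: "part \<alpha> x * part \<beta> y = (\<Sum>i<N. \<Sum>j<N.
    (fps_const (x (el (i, \<alpha>))) * gen_a ^ i) * (fps_const (y (el (j, \<beta>))) * gen_a ^ j))"
  unfolding part_eq sum_product ..

lemma part_times_sig: "part \<alpha> x * sig (part \<beta> y) = (\<Sum>i<N. \<Sum>j<N.
    (fps_const (x (el (i, \<alpha>))) * gen_a ^ i) * (fps_const (y (el (j, \<beta>))) * gen_a ^ (e * j)))"
  unfolding sig_part unfolding part_eq sum_product ..

lemma part_mult_False:
  "eqX N (part False (x \<otimes>\<^bsub>GA\<^esub> y)) (part False x * part False y + gen_a ^ c * (part True x * sig (part True y)))"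
proof -
  have "part False x * part False y + gen_a ^ c * (part True x * sig (part True y)) =
    (\<Sum>(r, s)\<in>I \<times> I. if (snd r \<noteq> snd s) = False
        then fps_const (x (el r)) * fps_const (y (el s)) * gen_a ^ exp_prod r s else 0)"
    unfolding sum_pairs part_times part_times_sig sum_distrib_left
    by (simp only: exp_prod_def fst_conv snd_conv if_True if_False simp_thms power_add add_0_right mult_ac)
  then show ?thesis using part_mult_sum[of False x y] by simp
qed

lemma part_mult_True:
  "eqX N (part True (x \<otimes>\<^bsub>GA\<^esub> y)) (part False x * part True y + part True x * sig (part False y))"
proof -
  have "part False x * part True y + part True x * sig (part False y) =
    (\<Sum>(r, s)\<in>I \<times> I. if (snd r \<noteq> snd s) = True
        then fps_const (x (el r)) * fps_const (y (el s)) * gen_a ^ exp_prod r s else 0)"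
    unfolding sum_pairs part_times part_times_sig
    by (simp only: exp_prod_def fst_conv snd_conv if_True if_False simp_thms power_add add_0_right mult_ac)
  then show ?thesis using part_mult_sum[of True x y] by simp
qed

lemma part_one: "part \<beta> \<one>\<^bsub>GA\<^esub> = (if \<beta> then 0 else 1)"
proof -
  have N: "0 < N" using N_p p_pos by simp
  have "\<one>\<^bsub>GA\<^esub> (el (i, \<beta>)) = (if i = 0 \<and> \<not> \<beta> then 1 else 0)" if "i < N" for i
    using that N by (auto simp: group_algebra_def one_el el_eq_iff)
  then have "part \<beta> \<one>\<^bsub>GA\<^esub> = (\<Sum>i<N. if i = 0 \<and> \<not> \<beta> then 1 else 0)"
    unfolding part_eq by (intro sum.cong) auto
  then show ?thesis using N by (cases \<beta>) simp_all
qed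

lemma part_in: "part \<beta> x \<in> trunc_set N"
  by (simp add: part_def)

text \<open>With \<open>u\<close>, \<open>v\<close> the two parts of \<open>x\<close>, the square has the parts \<open>u^2 + a^c norm v\<close> and
\<open>v (u + sig u)\<close>; the substitution \<open>y = 1 + u\<close> removes the constant from the first equation and
does not affect \<open>u + sig u\<close>.\<close>

lemma square_one_iff:
  "x \<otimes>\<^bsub>GA\<^esub> x = \<one>\<^bsub>GA\<^esub> \<longleftrightarrow> sol (1 + part False x) (part True x)"
proof -
  let ?u = "part False x" and ?v = "part True x"
  have "x \<otimes>\<^bsub>GA\<^esub> x = \<one>\<^bsub>GA\<^esub> \<longleftrightarrow>
      part False (x \<otimes>\<^bsub>GA\<^esub> x) = part False \<one>\<^bsub>GA\<^esub> \<and> part True (x \<otimes>\<^bsub>GA\<^esub> x) = part True \<one>\<^bsub>GA\<^esub>"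
    using parts_inj[OF mult_in one_in] by (metis (full_types))
  also have "\<dots> \<longleftrightarrow> eqX N (part False (x \<otimes>\<^bsub>GA\<^esub> x)) 1 \<and> eqX N (part True (x \<otimes>\<^bsub>GA\<^esub> x)) 0"
    using part_in trunc_eqX_eq part_one by (metis (full_types) eqX_refl)
  also have "\<dots> \<longleftrightarrow> eqX N (?u * ?u + gen_a ^ c * norm ?v) 1 \<and> eqX N (?u * ?v + ?v * sig ?u) 0"
    using part_mult_False[of x x] part_mult_True[of x x] unfolding norm_def
    by (blast intro: eqX_trans eqX_sym)
  also have "\<dots> \<longleftrightarrow> sol (1 + ?u) ?v"
  proof -
    have "eqX N (?u * ?u + gen_a ^ c * norm ?v) 1 \<longleftrightarrow> eqX N (?u * ?u + gen_a ^ c * norm ?v + 1) 0"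
      by (simp add: eqX_add_iff)
    also have "?u * ?u + gen_a ^ c * norm ?v + 1 = (1 + ?u)\<^sup>2 + gen_a ^ c * norm ?v"
      unfolding fps_bit_square_add by (simp add: power2_eq_square ac_simps)
    also have "eqX N \<dots> 0 \<longleftrightarrow> eqX N ((1 + ?u)\<^sup>2) (gen_a ^ c * norm ?v)" by (rule eqX_add_iff)
    finally have 1: "eqX N (?u * ?u + gen_a ^ c * norm ?v) 1 \<longleftrightarrow> eqX N ((1 + ?u)\<^sup>2) (gen_a ^ c * norm ?v)" .
    have "1 + ?u + sig (1 + ?u) = ?u + sig ?u" by (simp add: sig_add ac_simps)
    then have "?v * (1 + ?u + sig (1 + ?u)) = ?u * ?v + ?v * sig ?u"
      by (simp only: distrib_left mult.commute)
    with 1 show ?thesis unfolding sol_def by simp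
  qed
  finally show ?thesis .
qed

lemma augmentation_parts: "augmentation G x = part False x $ 0 + part True x $ 0"
proof -
  have "augmentation G x = (\<Sum>r\<in>I. x (el r))"
    unfolding augmentation_def using sum.reindex_bij_betw[OF el_bij, of x] by simp
  also have "\<dots> = (\<Sum>i<N. x (el (i, False))) + (\<Sum>i<N. x (el (i, True)))"
    by (rule sum_I)
  also have "\<dots> = part False x $ 0 + part True x $ 0"
    by (simp add: part_eq fps_sum_nth gen_a_pow_0)
  finally show ?thesis .
qed

text \<open>The augmentation is the constant term of \<open>u + v\<close>, which the first equation for an involution
determines.\<close>

lemma augmentation_involution:
  assumes "x \<otimes>\<^bsub>GA\<^esub> x = \<one>\<^bsub>GA\<^esub>"
  shows "augmentation G x = 1"
proof -
  let ?u = "part False x" and ?v = "part True x"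
  have "0 < N" using N_p p_pos by simp
  moreover have "eqX N ((1 + ?u)\<^sup>2) (gen_a ^ c * norm ?v)"
    using assms unfolding square_one_iff sol_def by blast
  ultimately have "((1 + ?u)\<^sup>2) $ 0 = (gen_a ^ c * norm ?v) $ 0" unfolding eqX_def by blast
  then have "1 + ?u $ 0 = ?v $ 0"
    by (cases "?u $ 0") (simp_all add: gen_a_pow_0 norm_0_nth power2_eq_square)
  then show ?thesis unfolding augmentation_parts
    by (cases "?u $ 0"; cases "?v $ 0") simp_all
qed

end

context maximal_class_presentation
begin

lemma one_mult: "x \<in> carrier GA \<Longrightarrow> \<one>\<^bsub>GA\<^esub> \<otimes>\<^bsub>GA\<^esub> x = x"
proof (rule parts_inj[OF mult_in])
  fix \<beta>
  assume "x \<in> carrier GA"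
  have "eqX N (part \<beta> (\<one>\<^bsub>GA\<^esub> \<otimes>\<^bsub>GA\<^esub> x)) (part \<beta> x)"
    using part_mult_False[of "\<one>\<^bsub>GA\<^esub>" x] part_mult_True[of "\<one>\<^bsub>GA\<^esub>" x] by (cases \<beta>) (simp_all add: part_one)
  then show "part \<beta> (\<one>\<^bsub>GA\<^esub> \<otimes>\<^bsub>GA\<^esub> x) = part \<beta> x" by (rule trunc_eqX_eq[OF part_in part_in])
qed

lemma normalized_square:
  assumes "x \<in> carrier GA"
  shows "x [^]\<^bsub>normalized_units G\<^esub> (2::nat) = x \<otimes>\<^bsub>GA\<^esub> x"
proof -
  have "x [^]\<^bsub>normalized_units G\<^esub> (2::nat) = \<one>\<^bsub>GA\<^esub> \<otimes>\<^bsub>GA\<^esub> x \<otimes>\<^bsub>GA\<^esub> x"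
    by (simp only: numeral_2_eq_2 nat_pow_Suc nat_pow_0 normalized_units_def monoid.simps)
  then show ?thesis by (simp only: one_mult[OF assms])
qed

lemma Theta2_card_involutions: "Theta2 G = card {x \<in> carrier GA. x \<otimes>\<^bsub>GA\<^esub> x = \<one>\<^bsub>GA\<^esub>}"
proof -
  have car: "x \<in> carrier (normalized_units G) \<longleftrightarrow> x \<in> carrier GA \<and> augmentation G x = 1" for x
    by (simp only: normalized_units_def partial_object.simps mem_Collect_eq)
  have one: "\<one>\<^bsub>normalized_units G\<^esub> = \<one>\<^bsub>GA\<^esub>"
    by (simp only: normalized_units_def monoid.simps)
  have "x \<in> carrier (normalized_units G) \<and> x [^]\<^bsub>normalized_units G\<^esub> (2::nat) = \<one>\<^bsub>normalized_units G\<^esub>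
      \<longleftrightarrow> x \<in> carrier GA \<and> x \<otimes>\<^bsub>GA\<^esub> x = \<one>\<^bsub>GA\<^esub>" for x
    unfolding car one using normalized_square[of x] augmentation_involution[of x] by metis
  then show ?thesis unfolding Theta2_def by (simp only:)
qed

lemma bij_solutions:
  "bij_betw (\<lambda>x. (1 + part False x, part True x)) {x \<in> carrier GA. x \<otimes>\<^bsub>GA\<^esub> x = \<one>\<^bsub>GA\<^esub>}
    {(y, v). y \<in> trunc_set N \<and> v \<in> trunc_set N \<and> sol y v}"
  (is "bij_betw ?m ?X ?S")
  unfolding bij_betw_def
proof
  have N: "0 < N" using N_p p_pos by simp
  have add1: "1 + f \<in> trunc_set N" if "f \<in> trunc_set N" for f
    using that N by (auto simp: trunc_set_def)
  show "inj_on ?m ?X"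
  proof (rule inj_onI)
    fix x y assume x: "x \<in> ?X" "y \<in> ?X" "?m x = ?m y"
    then have "part False x = part False y" "part True x = part True y" by simp_all
    then have "part \<beta> x = part \<beta> y" for \<beta> by (cases \<beta>) simp_all
    then show "x = y" using x parts_inj[of x y] by blast
  qed
  show "?m ` ?X = ?S"
  proof (intro equalityI subsetI)
    fix z assume "z \<in> ?m ` ?X"
    then obtain x where x: "z = ?m x" "x \<otimes>\<^bsub>GA\<^esub> x = \<one>\<^bsub>GA\<^esub>" by blast
    from x(2) have "sol (1 + part False x) (part True x)" unfolding square_one_iff .
    then show "z \<in> ?S" using add1[OF part_in] part_in by (simp add: x(1))
  next
    fix z assume "z \<in> ?S"
    then obtain y v where z: "z = (y, v)" "y \<in> trunc_set N" "v \<in> trunc_set N" "sol y v" by blast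
    obtain x where x: "x \<in> carrier GA" "part False x = 1 + y" "part True x = v"
      using parts_surj[OF add1[OF z(2)] z(3)] by blast
    have y: "1 + part False x = y" by (simp add: x)
    then have "z = ?m x" by (simp add: z x)
    moreover have "x \<otimes>\<^bsub>GA\<^esub> x = \<one>\<^bsub>GA\<^esub>" unfolding square_one_iff y x using z by simp
    ultimately show "z \<in> ?m ` ?X" using x(1) by blast
  qed
qed

lemma Theta2_eq: "Theta2 G = 2 ^ N + 2 ^ (2 * p) * unit_fibre + (p - 1) * 2 ^ (N + 1)"
  unfolding Theta2_card_involutions bij_betw_same_card[OF bij_solutions] by (rule card_solutions)

end

section \<open>The three families\<close>

lemma Theta2_presented:
  assumes "2 \<le> n"
    and "e = 2 ^ n - 1 \<or> e = 2 ^ (n - 1) - 1 \<and> 3 \<le> n"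
    and "c = 0 \<or> c = 2 ^ (n - 1) \<and> e = 2 ^ n - 1"
    and "(2::int) ^ n dvd d + 1 - int e"
  shows "int (Theta2 (presented_group {(word_pow wa (2 ^ n), []), (word_pow wb 2, word_pow wa (int c)),
     (word_comm wa wb, word_pow wa d)})) =
     2 ^ (2 ^ n + n - 1) + (if c \<noteq> 0 then - (2 ^ (2 ^ n)) else if e = 2 ^ n - 1 then 2 ^ (2 ^ n) else 0)"
proof -
  obtain m where m: "n = Suc (Suc m)" using assms(1) by (metis Suc_le_D numeral_2_eq_2 Suc_le_mono)
  define p :: nat where "p = 2 ^ m"
  have p2: "2 * p = 2 ^ (n - 1)" by (simp add: p_def m)
  interpret maximal_class_presentation n e c "2 ^ n" p d
  proof
    show "2 ^ n = 4 * p" by (simp add: p_def m)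
  qed (use assms p2 in auto)
  have p: "2 ^ n = 4 * p" "0 < p" by (simp_all add: p_def m)
  define Q :: int where "Q = 2 ^ (2 ^ n)"
  have "(2::int) ^ (2 * p) * 2 ^ (2 * p) = Q"
    unfolding Q_def p by (simp flip: power_add)
  then have low: "(2::int) ^ (2 * p) * int unit_fibre = (if c \<noteq> 0 then 0 else if e = 2 ^ n - 1 then 2 * Q else Q)"
    by (simp add: unit_fibre_def)
  have "(2::int) ^ (2 ^ n + n - 1) = Q * 2 ^ (n - 1)"
    using m by (simp add: Q_def flip: power_add)
  also have "(2::int) ^ (n - 1) = int (2 * p)" unfolding p2 by simp
  finally have main: "(2::int) ^ (2 ^ n + n - 1) = 2 * Q * int p" by simp
  have "int (Theta2 G) = Q + (2::int) ^ (2 * p) * int unit_fibre + int (p - 1) * (2 * Q)"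
    unfolding Theta2_eq by (simp add: Q_def)
  also have "\<dots> = 2 * Q * int p + (if c \<noteq> 0 then - Q else if e = 2 ^ n - 1 then Q else 0)"
    unfolding low using p(2) by (simp add: of_nat_diff algebra_simps)
  finally show ?thesis unfolding main Q_def G_def rels_def .
qed

theorem mainTheorem1:
  shows "(\<forall>n::nat. n \<ge> 2 \<longrightarrow> Theta2 (dihedral_group n) = 2 ^ (2 ^ n + n - 1) + 2 ^ (2 ^ n))
       \<and> (\<forall>n::nat. n \<ge> 3 \<longrightarrow> Theta2 (semidihedral_group n) = 2 ^ (2 ^ n + n - 1))
       \<and> (\<forall>n::nat. n \<ge> 2 \<longrightarrow> int (Theta2 (quaternion_group n)) = 2 ^ (2 ^ n + n - 1) - 2 ^ (2 ^ n))"
proof (intro conjI allI impI)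
  fix n :: nat
  assume n: "2 \<le> n"
  have e: "int (2 ^ n - 1) = 2 ^ n - 1" by (simp add: of_nat_diff)
  have pow0: "word_pow wa (int 0) = []" by (simp add: word_pow_def)
  have "int (Theta2 (dihedral_group n)) = 2 ^ (2 ^ n + n - 1) + 2 ^ (2 ^ n)"
    using Theta2_presented[of n "2 ^ n - 1" 0 "- 2"] n unfolding dihedral_group_def pow0 e by simp
  then have "int (Theta2 (dihedral_group n)) = int (2 ^ (2 ^ n + n - 1) + 2 ^ (2 ^ n))" by simp
  then show "Theta2 (dihedral_group n) = 2 ^ (2 ^ n + n - 1) + 2 ^ (2 ^ n)"
    by (simp only: of_nat_eq_iff)
  have "int (2 ^ (n - 1)) = 2 ^ (n - 1)" by simp
  then show "int (Theta2 (quaternion_group n)) = 2 ^ (2 ^ n + n - 1) - 2 ^ (2 ^ n)"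
    using Theta2_presented[of n "2 ^ n - 1" "2 ^ (n - 1)" "- 2"] n unfolding quaternion_group_def e by simp
next
  fix n :: nat
  assume n: "3 \<le> n"
  have e: "int (2 ^ (n - 1) - 1) = 2 ^ (n - 1) - 1" by (simp add: of_nat_diff)
  have pow0: "word_pow wa (int 0) = []" by (simp add: word_pow_def)
  have "(2::nat) ^ (n - 1) < 2 ^ n" using n by (intro power_strict_increasing) auto
  then have "(2::nat) ^ (n - 1) - 1 < 2 ^ n - 1" by (rule diff_less_mono) simp
  then have ne: "(2::nat) ^ (n - 1) - 1 \<noteq> 2 ^ n - 1" by (rule less_imp_neq)
  have "int (Theta2 (semidihedral_group n)) = 2 ^ (2 ^ n + n - 1)"
    using Theta2_presented[of n "2 ^ (n - 1) - 1" 0 "- 2 + 2 ^ (n - 1)"] n ne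
    unfolding semidihedral_group_def pow0 e by simp
  then have "int (Theta2 (semidihedral_group n)) = int (2 ^ (2 ^ n + n - 1))" by simp
  then show "Theta2 (semidihedral_group n) = 2 ^ (2 ^ n + n - 1)"
    by (simp only: of_nat_eq_iff)
qed

end
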